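(* Let $p>1$, let $G=(V,E)$ be a finite connected graph with $V=\{1,\dots,n\}$, and for each edge $(i,j)\in E$ let $\widetilde{R}_{ij}\in \mathrm{SO}(3)$ be given. Consider the $l_p$ geodesic rotation averaging cost $$\phi_p(\mathcal{R})=\sum_{(i,j)\in E} d\big(\widetilde{R}_{ij},\,R_iR_j^\top\big)^p,\qquad \mathcal{R}=(R_1,\dots,R_n)\in \mathrm{SO}(3)^n,$$ where $d(R,S)=\angle(R^\top S)\in[0,\pi]$. Let $\mathcal{R}\in \mathrm{SO}(3)^n$ be a point in a neighbourhood of which $\phi_p$ is twice continuously differentiable, let $\mathbf{H}$ be the $3n\times 3n$ Hessian matrix of $\phi_p$ (as a function on $\mathrm{SO}(3)^n$) at $\mathcal{R}$, and let $\mathcal{V}=\{(\mathbf{v},\mathbf{v},\dots,\mathbf{v}) : \mathbf{v}\in\mathbb{R}^3\}\subset(\mathbb{R}^3)^n\cong\mathbb{R}^{3n}$. If $$\min_{\mathbf{x}\in \mathcal{V}^\perp,\ \|\mathbf{x}\|=1}\ \mathbf{x}^\top\mathbf{H}\,\mathbf{x}>0,$$ then the rotation averaging problem $(G,\widetilde{\mathcal{R}})$, regarded as the problem of minimizing the function induced by $\phi_p$ on the quotient manifold $\mathrm{SO}(3)^n/(\mathcal{R}\sim\mathcal{R}S,\ S\in\mathrm{SO}(3))$, is locally convex at (the class of) $\mathcal{R}$.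
   Context: For $R\in\mathrm{SO}(3)$, $\angle(R)\in[0,\pi]$ is the rotation angle of $R$, so $d$ is the geodesic (intrinsic) distance on $\mathrm{SO}(3)$. $G$ is treated as undirected: each edge contributes one term, and reversing an edge replaces $\widetilde{R}_{ij}$ by $\widetilde{R}_{ji}=\widetilde{R}_{ij}^\top$. Write $\widetilde{\mathcal{R}}=\{\widetilde{R}_{ij}:(i,j)\in E\}$. Tangent vectors to $\mathrm{SO}(3)^n$ at $\mathcal{R}$ are identified with $\mathbf{x}=(\mathbf{x}_1,\dots,\mathbf{x}_n)\in(\mathbb{R}^3)^n$ via $$\exp_{\mathcal{R}}(\mathbf{x})=(R_1\exp[\mathbf{x}_1]_\times,\dots,R_n\exp[\mathbf{x}_n]_\times),$$ where $[\mathbf{v}]_\times$ is the skew-symmetric $3\times3$ matrix with $[\mathbf{v}]_\times\mathbf{u}=\mathbf{v}\times\mathbf{u}$. The Riemannian metric on $\mathrm{SO}(3)^n$ is the product bi-invariant metric for which $\|\mathbf{x}\|$ is the Euclidean norm on $\mathbb{R}^{3n}$ (so that geodesic distance on each factor is $d$). The Hessian $\mathbf{H}$ at $\mathcal{R}$ is the Riemannian Hessian, i.e. the symmetric matrix with $\mathbf{x}^\top\mathbf{H}\mathbf{x}=\frac{d^2}{dt^2}\big|_{t=0}\phi_p(\exp_{\mathcal{R}}(t\mathbf{x}))$ for all $\mathbf{x}\in\mathbb{R}^{3n}$. Gauge: for $S\in\mathrm{SO}(3)$ put $\mathcal{R}S=(R_1S,\dots,R_nS)$. The cost $\phi_p$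 is invariant under $\mathcal{R}\mapsto\mathcal{R}S$, and this is a free isometric action of $\mathrm{SO}(3)$ on $\mathrm{SO}(3)^n$, so $\phi_p$ descends to a function on the quotient manifold $\mathrm{SO}(3)^n/\sim$, which carries the quotient Riemannian metric, with distance $d_{\mathrm{quot}}(\mathcal{R}_1,\mathcal{R}_2)=\min_{S\in\mathrm{SO}(3)}d(\mathcal{R}_1,\mathcal{R}_2S)$ ($d$ here being the distance on $\mathrm{SO}(3)^n$). The tangent space of the gauge orbit at every point is the vertical space $\mathcal{V}$; its orthogonal complement $\mathcal{V}^\perp$ in $\mathbb{R}^{3n}$ is the horizontal space. Local convexity: the problem is locally convex at a point if there is an open ball around that point on which the cost function is convex, meaning convex along geodesics of the manifold contained in that ball. Here the manifold is the quotient manifold $\mathrm{SO}(3)^n/\sim$. *)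

theory Defs
  imports "HOL-Analysis.Analysis"
begin

section \<open>Rotations\<close>

definition SO3 :: "(real^3^3) set" where
  "SO3 = Collect rotation_matrix"

text \<open>The angle in $[0,\pi]$, read off from $\mathrm{tr}\,R = 1 + 2\cos\theta$; see
  \<open>rotation_angle_exp_skew\<close> below.\<close>
definition rotation_angle :: "real^3^3 \<Rightarrow> real" where
  "rotation_angle R = arccos ((trace R - 1) / 2)"

definition rot_dist :: "real^3^3 \<Rightarrow> real^3^3 \<Rightarrow> real" where
  "rot_dist R S = rotation_angle (transpose R ** S)"

text \<open>The type \<^typ>\<open>real^3^3\<close> carries the componentwise product, so the matrix exponential
  is spelled out as a series.\<close>
definition mat_exp :: "real^3^3 \<Rightarrow> real^3^3" where
  "mat_exp A = (\<Sum>k. (1 / fact k) *\<^sub>R (((**) A ^^ k) (mat 1)))"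

definition skew :: "real^3 \<Rightarrow> real^3^3" where
  "skew v = matrix (cross3 v)"


section \<open>Configurations of rotations indexed by the vertices\<close>

text \<open>The vertex set is the finite index type \<^typ>\<open>'n\<close>.\<close>

type_synonym 'n config = "real^3^3^'n"
type_synonym 'n tangent = "real^3^'n"

definition SO3n :: "('n::finite) config set" where
  "SO3n = {R. \<forall>i. R $ i \<in> SO3}"

definition config_dist :: "('n::finite) config \<Rightarrow> 'n config \<Rightarrow> real" where
  "config_dist P Q = sqrt (\<Sum>i\<in>UNIV. (rot_dist (P $ i) (Q $ i))\<^sup>2)"

definition config_exp :: "('n::finite) config \<Rightarrow> 'n tangent \<Rightarrow> 'n config" where
  "config_exp R x = (\<chi> i. R $ i ** mat_exp (skew (x $ i)))"


section \<open>The cost\<close>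

text \<open>An undirected simple graph is given by its edge set \<open>E\<close>, in which every edge is listed
  once, with an arbitrary orientation.\<close>
definition oriented_connected_graph :: "('n \<times> 'n) set \<Rightarrow> bool" where
  "oriented_connected_graph E \<longleftrightarrow> asym E \<and> (\<forall>i j. (i, j) \<in> (E \<union> E\<inverse>)\<^sup>*)"

definition averaging_cost ::
    "real \<Rightarrow> (('n::finite) \<times> 'n) set \<Rightarrow> ('n \<Rightarrow> 'n \<Rightarrow> real^3^3) \<Rightarrow> 'n config \<Rightarrow> real" where
  "averaging_cost p E Rt R =
     (\<Sum>(i, j)\<in>E. rot_dist (Rt i j) (R $ i ** transpose (R $ j)) powr p)"


section \<open>Smoothness and the Riemannian Hessian\<close>

definition C2_on :: "('a::real_normed_vector) set \<Rightarrow> ('a \<Rightarrow> real) \<Rightarrow> bool" where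
  "C2_on U f \<longleftrightarrow> (\<exists>(f' :: 'a \<Rightarrow> 'a \<Rightarrow>\<^sub>L real) (f'' :: 'a \<Rightarrow> 'a \<Rightarrow>\<^sub>L 'a \<Rightarrow>\<^sub>L real).
     (\<forall>x\<in>U. (f has_derivative blinfun_apply (f' x)) (at x)) \<and>
     (\<forall>x\<in>U. (f' has_derivative blinfun_apply (f'' x)) (at x)) \<and>
     continuous_on U f'')"

text \<open>The map \<^term>\<open>config_exp R\<close> restricted to a small ball around \<open>0\<close> is a chart of
  $\mathrm{SO}(3)^n$ around \<open>R\<close>.\<close>
definition C2_near :: "(('n::finite) config \<Rightarrow> real) \<Rightarrow> 'n config \<Rightarrow> bool" where
  "C2_near f R \<longleftrightarrow> (\<exists>r>0. C2_on (ball 0 r) (\<lambda>x. f (config_exp R x)))"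

definition has_second_derivative :: "(real \<Rightarrow> real) \<Rightarrow> real \<Rightarrow> real \<Rightarrow> bool" where
  "has_second_derivative g q t \<longleftrightarrow>
     (\<exists>g'. (\<forall>\<^sub>F s in nhds t. (g has_real_derivative g' s) (at s)) \<and>
           (g' has_real_derivative q) (at t))"

definition stack :: "('n::finite) tangent \<Rightarrow> real ^ ('n \<times> 3)" where
  "stack x = (\<chi> a. x $ fst a $ snd a)"

definition quad_form :: "real ^ ('n \<times> 3) ^ ('n \<times> 3) \<Rightarrow> ('n::finite) tangent \<Rightarrow> real" where
  "quad_form H x = stack x \<bullet> (H *v stack x)"

definition is_riemannian_hessian ::
    "(('n::finite) config \<Rightarrow> real) \<Rightarrow> 'n config \<Rightarrow> real ^ ('n \<times> 3) ^ ('n \<times> 3) \<Rightarrow> bool" where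
  "is_riemannian_hessian f R H \<longleftrightarrow> transpose H = H \<and>
     (\<forall>x. has_second_derivative (\<lambda>t. f (config_exp R (t *\<^sub>R x))) (quad_form H x) 0)"

definition vertical_space :: "('n::finite) tangent set" where
  "vertical_space = range (\<lambda>v. \<chi> i. v)"


section \<open>The quotient by the gauge action\<close>

definition gauge_act :: "('n::finite) config \<Rightarrow> real^3^3 \<Rightarrow> 'n config" where
  "gauge_act R S = (\<chi> i. R $ i ** S)"

definition gauge_rel :: "(('n::finite) config \<times> 'n config) set" where
  "gauge_rel = {(P, Q). P \<in> SO3n \<and> (\<exists>S\<in>SO3. Q = gauge_act P S)}"

abbreviation gauge_class :: "('n::finite) config \<Rightarrow> 'n config set" where
  "gauge_class R \<equiv> gauge_rel `` {R}"

definition gauge_quotient :: "('n::finite) config set set" where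
  "gauge_quotient = SO3n // gauge_rel"

definition gauge_dist :: "('n::finite) config \<Rightarrow> 'n config \<Rightarrow> real" where
  "gauge_dist P Q = (INF S\<in>SO3. config_dist P (gauge_act Q S))"

text \<open>The functions induced on classes: by gauge invariance the images below are singletons
  (see \<open>quot_dist_class\<close> and \<open>quot_fun_averaging_cost\<close>).\<close>

definition quot_dist :: "('n::finite) config set \<Rightarrow> 'n config set \<Rightarrow> real" where
  "quot_dist X Y = the_elem ((\<lambda>(P, Q). gauge_dist P Q) ` (X \<times> Y))"

definition quot_fun :: "(('n::finite) config \<Rightarrow> real) \<Rightarrow> 'n config set \<Rightarrow> real" where
  "quot_fun f X = the_elem (f ` X)"

text \<open>The geodesics of a Riemannian manifold are exactly the curves of constant speed that
  locally minimise the Riemannian distance.\<close>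
definition quot_geodesic :: "(real \<Rightarrow> ('n::finite) config set) \<Rightarrow> real \<Rightarrow> real \<Rightarrow> bool" where
  "quot_geodesic \<gamma> a b \<longleftrightarrow> (\<forall>t\<in>{a..b}. \<gamma> t \<in> gauge_quotient) \<and>
     (\<exists>c\<ge>0. \<forall>t\<in>{a..b}. \<exists>e>0. \<forall>s\<in>{a..b} \<inter> ball t e. \<forall>s'\<in>{a..b} \<inter> ball t e.
        quot_dist (\<gamma> s) (\<gamma> s') = c * \<bar>s - s'\<bar>)"

definition quot_ball :: "('n::finite) config set \<Rightarrow> real \<Rightarrow> 'n config set set" where
  "quot_ball X r = {Y \<in> gauge_quotient. quot_dist X Y < r}"

definition quot_convex_on ::
    "('n::finite) config set set \<Rightarrow> ('n config set \<Rightarrow> real) \<Rightarrow> bool" where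
  "quot_convex_on B F \<longleftrightarrow>
     (\<forall>\<gamma> a b. quot_geodesic \<gamma> a b \<and> \<gamma> ` {a..b} \<subseteq> B \<longrightarrow> convex_on {a..b} (\<lambda>t. F (\<gamma> t)))"

definition quot_locally_convex_at ::
    "(('n::finite) config set \<Rightarrow> real) \<Rightarrow> 'n config set \<Rightarrow> bool" where
  "quot_locally_convex_at F X \<longleftrightarrow> (\<exists>r>0. quot_convex_on (quot_ball X r) F)"


section \<open>Sanity lemmas\<close>

subsection \<open>The rotation angle\<close>

lemma mat_exp_sums: "(\<lambda>k. (1 / fact k) *\<^sub>R (((**) A ^^ k) (mat 1))) sums mat_exp A"
proof -
  have "linear (\<lambda>B::real^3^3. A ** B)"
    by (rule linearI)
       (simp_all add: matrix_matrix_mult_def vec_eq_iff sum.distrib distrib_left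
         sum_distrib_left mult.left_commute)
  then have bl: "bounded_linear (\<lambda>B::real^3^3. A ** B)"
    by (simp add: linear_conv_bounded_linear)
  then obtain K where K: "K > 0" "\<And>B :: real^3^3. norm (A ** B) \<le> norm B * K"
    using bounded_linear.pos_bounded[OF bl] by auto
  have b: "norm ((((**) A ^^ k) (mat 1))) \<le> norm (mat 1 :: real^3^3) * K ^ k" for k
  proof (induction k)
    case (Suc k)
    have "norm (((**) A ^^ Suc k) (mat 1)) \<le> norm (((**) A ^^ k) (mat 1)) * K"
      using K(2) by simp
    also have "\<dots> \<le> norm (mat 1 :: real^3^3) * K ^ k * K"
      using Suc K(1) by (intro mult_right_mono) auto
    finally show ?case by (simp add: mult_ac)
  qed simp
  have "summable (\<lambda>k. norm (mat 1 :: real^3^3) * (K ^ k /\<^sub>R fact k))"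
    by (intro summable_mult summable_exp_generic)
  then have "summable (\<lambda>k. (1 / fact k) *\<^sub>R (((**) A ^^ k) (mat 1)))"
    by (rule summable_comparison_test')
       (use b in \<open>auto simp: divide_simps mult_ac\<close>)
  then show ?thesis
    unfolding mat_exp_def by (rule summable_sums)
qed

lemma skew_mult: "skew v *v u = cross3 v u"
proof -
  have "linear (cross3 v)"
    by (rule linearI) (auto simp: cross3_simps)
  then show ?thesis unfolding skew_def by (simp add: matrix_works)
qed

lemma skew_cube: "skew v ** (skew v ** (skew v ** B)) = - ((norm v)\<^sup>2) *\<^sub>R (skew v ** B)"
proof -
  have "cross3 v (cross3 v (cross3 v u)) = - ((norm v)\<^sup>2) *\<^sub>R cross3 v u" for u
    by (simp add: power2_norm_eq_inner) (simp add: cross3_simps)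
  then have "(skew v ** (skew v ** (skew v ** B))) *v x = (- ((norm v)\<^sup>2) *\<^sub>R (skew v ** B)) *v x" for x
    unfolding matrix_vector_mul_assoc[symmetric] scaleR_matrix_vector_assoc[symmetric] skew_mult .
  then show ?thesis by (simp add: matrix_eq)
qed

lemma skew_entries:
  "skew v = vector [vector [0, - v$3, v$2], vector [v$3, 0, - v$1], vector [- v$2, v$1, 0]]"
  by (simp add: skew_def matrix_def cross3_def vec_eq_iff forall_3 axis_def)

lemma trace_skew_power:
  "trace (((**) (skew v) ^^ k) (mat 1)) / fact k =
     2 * (cos_coeff k * norm v ^ k) + (if k = 0 then 1 else 0)"
proof -
  define M where "M k = ((**) (skew v) ^^ k) (mat 1)" for k
  have M0: "M 0 = mat 1" and MS: "M (Suc k) = skew v ** M k" for k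
    by (simp_all add: M_def)
  have step: "trace (M (Suc (Suc (Suc k)))) = - ((norm v)\<^sup>2) * trace (M (Suc k))" for k
    unfolding MS skew_cube by (simp add: trace_def sum_distrib_left)
  have odd: "trace (M (Suc (2 * k))) = 0" for k
  proof (induction k)
    case 0 show ?case by (simp add: MS M0 trace_def sum_3 skew_entries)
  next
    case (Suc k) then show ?case using step[of "2 * k"] by simp
  qed
  have even: "trace (M (Suc (Suc (2 * k)))) = 2 * ((-1) ^ Suc k * norm v ^ Suc (Suc (2 * k)))" for k
  proof (induction k)
    case 0
    have n: "norm v * norm v = v$1 * v$1 + v$2 * v$2 + v$3 * v$3"
      using power2_norm_eq_inner[of v] by (simp add: inner_vec_def sum_3 power2_eq_square)
    have "M (Suc (Suc (2 * 0))) = skew v ** skew v"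
      by (simp add: MS M0)
    then show ?case
      by (simp add: trace_def sum_3 skew_entries matrix_matrix_mult_def n)
  next
    case (Suc k)
    have "trace (M (Suc (Suc (2 * Suc k)))) = - ((norm v)\<^sup>2) * trace (M (Suc (Suc (2 * k))))"
      using step[of "Suc (2 * k)"] by simp
    then show ?case unfolding Suc by (simp add: power2_eq_square)
  qed
  consider "k = 0" | j where "k = Suc (Suc (2 * j))" | j where "k = Suc (2 * j)"
  proof (cases "even k")
    case True
    then obtain j where j: "k = 2 * j" by blast
    with that show thesis by (cases j) auto
  next
    case False
    then obtain j where "k = Suc (2 * j)" by (auto elim: oddE)
    with that show thesis by blast
  qed
  then have "trace (M k) / fact k = 2 * (cos_coeff k * norm v ^ k) + (if k = 0 then 1 else 0)"
  proof cases
    case 1 then show ?thesis by (simp add: M0 trace_I)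
  next
    case 2
    show ?thesis unfolding 2 even by (simp add: cos_coeff_def del: fact_Suc)
  next
    case 3
    show ?thesis unfolding 3 odd by (simp add: cos_coeff_def)
  qed
  then show ?thesis by (simp add: M_def)
qed

lemma trace_exp_skew: "trace (mat_exp (skew v)) = 1 + 2 * cos (norm v)"
proof -
  have "linear (trace :: real^3^3 \<Rightarrow> real)"
    by (rule linearI) (auto simp: trace_def sum.distrib sum_distrib_left)
  then have bl: "bounded_linear (trace :: real^3^3 \<Rightarrow> real)"
    by (simp add: linear_conv_bounded_linear)
  have scale: "trace ((1 / fact k) *\<^sub>R B) = trace B / fact k" for k and B :: "real^3^3"
    by (simp add: linear_cmul[OF bounded_linear.linear[OF bl]])
  have "(\<lambda>k. 2 * (cos_coeff k * norm v ^ k) + (if k = 0 then 1 else 0)) sums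
      trace (mat_exp (skew v))"
    using bounded_linear.sums[OF bl mat_exp_sums[of "skew v"]]
    unfolding scale trace_skew_power .
  moreover have "(\<lambda>k. 2 * (cos_coeff k * norm v ^ k) + (if k = 0 then 1 else 0)) sums
      (2 * cos (norm v) + 1)"
    using cos_converges[of "norm v"] sums_single[of 0 "\<lambda>_. 1 :: real"]
    by (intro sums_add sums_mult) simp_all
  ultimately show ?thesis using sums_unique2 by fastforce
qed

lemma rotation_angle_exp_skew:
  assumes "norm v \<le> pi"
  shows "rotation_angle (mat_exp (skew v)) = norm v"
  using assms by (simp add: rotation_angle_def trace_exp_skew arccos_cos)


subsection \<open>Orientation of the edges is immaterial\<close>

lemma trace_transpose: "trace (transpose A) = trace (A :: real^'n^'n)"
  by (simp add: trace_def transpose_def)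

lemma rot_dist_transpose: "rot_dist (transpose A) (Q ** transpose P) = rot_dist A (P ** transpose Q)"
proof -
  have "trace (A ** (Q ** transpose P)) = trace (transpose (A ** (Q ** transpose P)))"
    by (simp only: trace_transpose)
  also have "\<dots> = trace ((P ** transpose Q) ** transpose A)"
    by (simp only: matrix_transpose_mul transpose_transpose)
  also have "\<dots> = trace (transpose A ** (P ** transpose Q))"
    by (rule trace_mul_sym)
  finally have "trace (A ** (Q ** transpose P)) = trace (transpose A ** (P ** transpose Q))" .
  then show ?thesis by (simp add: rot_dist_def rotation_angle_def)
qed


subsection \<open>Gauge invariance\<close>

lemma SO3_mult: "A \<in> SO3 \<Longrightarrow> B \<in> SO3 \<Longrightarrow> A ** B \<in> SO3"
  by (simp add: SO3_def rotation_matrix_def orthogonal_matrix_mul det_mul)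

lemma SO3_transpose: "A \<in> SO3 \<Longrightarrow> transpose A \<in> SO3"
  by (simp add: SO3_def rotation_matrix_def)

lemma SO3_one: "mat 1 \<in> SO3"
  by (simp add: SO3_def rotation_matrix_def orthogonal_matrix_id)

lemma SO3_cancel:
  assumes "A \<in> SO3"
  shows "transpose A ** A = mat 1" "A ** transpose A = mat 1"
  using assms by (simp_all add: SO3_def rotation_matrix_def orthogonal_matrix_def)

lemma gauge_act_one: "gauge_act P (mat 1) = P"
  by (simp add: gauge_act_def vec_eq_iff)

lemma gauge_act_act: "gauge_act (gauge_act P S) T = gauge_act P (S ** T)"
  by (simp add: gauge_act_def vec_eq_iff matrix_mul_assoc)

lemma gauge_act_SO3n: "P \<in> SO3n \<Longrightarrow> S \<in> SO3 \<Longrightarrow> gauge_act P S \<in> SO3n"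
  by (simp add: SO3n_def gauge_act_def SO3_mult)

lemma equiv_gauge_rel: "equiv SO3n (gauge_rel :: (('n::finite) config \<times> 'n config) set)"
proof (rule equivI)
  show "gauge_rel \<subseteq> (SO3n :: 'n config set) \<times> SO3n"
    by (auto simp: gauge_rel_def gauge_act_SO3n)
  show "refl_on (SO3n :: 'n config set) gauge_rel"
    using SO3_one by (force intro!: refl_onI simp: gauge_rel_def gauge_act_one)
  show "sym (gauge_rel :: ('n config \<times> 'n config) set)"
  proof (rule symI)
    fix P Q :: "'n config" assume "(P, Q) \<in> gauge_rel"
    then obtain S where S: "P \<in> SO3n" "S \<in> SO3" "Q = gauge_act P S"
      by (auto simp: gauge_rel_def)
    then have "P = gauge_act Q (transpose S)"
      by (simp add: gauge_act_act SO3_cancel gauge_act_one)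
    with S show "(Q, P) \<in> gauge_rel"
      unfolding gauge_rel_def using gauge_act_SO3n SO3_transpose by blast
  qed
  show "trans (gauge_rel :: ('n config \<times> 'n config) set)"
    by (rule transI) (auto simp: gauge_rel_def gauge_act_act intro: SO3_mult)
qed

lemma rot_dist_right_invariant:
  assumes "S \<in> SO3"
  shows "rot_dist (A ** S) (B ** S) = rot_dist A B"
proof -
  have "trace (transpose S ** ((transpose A ** B) ** S)) = trace (transpose A ** B)"
    by (metis SO3_cancel(2)[OF assms] trace_mul_sym matrix_mul_assoc matrix_mul_rid)
  then show ?thesis
    by (simp add: rot_dist_def rotation_angle_def matrix_transpose_mul matrix_mul_assoc)
qed

lemma config_dist_gauge:
  "S \<in> SO3 \<Longrightarrow> config_dist (gauge_act P S) (gauge_act Q S) = config_dist P Q"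
  by (simp add: config_dist_def gauge_act_def rot_dist_right_invariant)

lemma gauge_dist_gauge:
  assumes "S \<in> SO3" "T \<in> SO3"
  shows "gauge_dist (gauge_act P S) (gauge_act Q T) = gauge_dist P Q"
proof -
  have eq: "config_dist (gauge_act P S) (gauge_act (gauge_act Q T) U) =
      config_dist P (gauge_act Q (T ** U ** transpose S))" if "U \<in> SO3" for U
    using config_dist_gauge[OF SO3_transpose[OF assms(1)], of "gauge_act P S" "gauge_act (gauge_act Q T) U"]
    by (simp add: gauge_act_act SO3_cancel assms gauge_act_one)
  have "(\<lambda>U. config_dist (gauge_act P S) (gauge_act (gauge_act Q T) U)) ` SO3 =
      (\<lambda>W. config_dist P (gauge_act Q W)) ` ((\<lambda>U. T ** U ** transpose S) ` SO3)"
    unfolding image_image by (rule image_cong) (simp_all add: eq)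
  also have "(\<lambda>U. T ** U ** transpose S) ` SO3 = SO3"
  proof (intro equalityI subsetI)
    fix W assume W: "W \<in> SO3"
    have "T ** (transpose T ** W ** S) ** transpose S = (T ** transpose T) ** W ** (S ** transpose S)"
      by (simp add: matrix_mul_assoc)
    also have "\<dots> = W"
      by (simp add: SO3_cancel assms)
    finally have "W = T ** (transpose T ** W ** S) ** transpose S" ..
    then show "W \<in> (\<lambda>U. T ** U ** transpose S) ` SO3"
      by (rule image_eqI) (intro SO3_mult SO3_transpose W assms)
  qed (auto intro!: SO3_mult SO3_transpose assms)
  finally show ?thesis by (simp add: gauge_dist_def)
qed

lemma gauge_class_SO3n:
  assumes "P \<in> SO3n"
  shows "gauge_class P = gauge_act P ` SO3"
  using assms by (auto simp: gauge_rel_def)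

lemma quot_dist_class:
  fixes P Q :: "('a::finite) config"
  assumes "P \<in> SO3n" "Q \<in> SO3n"
  shows "quot_dist (gauge_class P) (gauge_class Q) = gauge_dist P Q"
proof -
  have "gauge_dist P' Q' = gauge_dist P Q" if "P' \<in> gauge_class P" "Q' \<in> gauge_class Q" for P' Q'
    using that unfolding gauge_class_SO3n[OF assms(1)] gauge_class_SO3n[OF assms(2)]
    by (auto simp: gauge_dist_gauge)
  moreover have "gauge_class P \<times> gauge_class Q \<noteq> {}"
    using SO3_one unfolding gauge_class_SO3n[OF assms(1)] gauge_class_SO3n[OF assms(2)] by auto
  moreover have "(\<lambda>(P, Q). gauge_dist P Q) ` (A \<times> B) = {c}"
    if "\<And>P Q. P \<in> A \<Longrightarrow> Q \<in> B \<Longrightarrow> gauge_dist P Q = c" "A \<times> B \<noteq> {}"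
    for A B :: "'a config set" and c
    using that by force
  ultimately have "(\<lambda>(P, Q). gauge_dist P Q) ` (gauge_class P \<times> gauge_class Q) = {gauge_dist P Q}"
    by blast
  then show ?thesis by (simp add: quot_dist_def)
qed

lemma averaging_cost_gauge:
  assumes "S \<in> SO3"
  shows "averaging_cost p E Rt (gauge_act R S) = averaging_cost p E Rt R"
proof -
  have "(A ** S) ** transpose (B ** S) = A ** transpose B" for A B :: "real^3^3"
    by (metis SO3_cancel(2)[OF assms] matrix_mul_assoc matrix_mul_rid matrix_transpose_mul)
  then show ?thesis by (simp add: averaging_cost_def gauge_act_def)
qed

lemma quot_fun_averaging_cost:
  assumes "R \<in> SO3n"
  shows "quot_fun (averaging_cost p E Rt) (gauge_class R) = averaging_cost p E Rt R"
proof -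
  have "averaging_cost p E Rt ` gauge_class R = {averaging_cost p E Rt R}"
    using SO3_one by (auto simp: gauge_class_SO3n[OF assms] image_image averaging_cost_gauge)
  then show ?thesis by (simp add: quot_fun_def)
qed

end

theory Submission
  imports Defs
begin

text \<open>
  A metric geodesic of the quotient lifts, near each interior time, to a curve
  \<open>config_exp M (t *\<^sub>R w)\<close>: minimal representatives on both sides of a point realise equality in the
  triangle inequality of $\mathrm{SO}(3)^n$, and the equality cases of the triangle inequalities for the
  rotation angle and for the Euclidean norm force the two pieces to be aligned. Minimality along the gauge
  orbit makes \<open>w\<close> horizontal. It remains to see that the second derivative of the cost along
  \<open>config_exp M (t *\<^sub>R w)\<close> is nonnegative for \<open>M\<close> near \<open>R\<close> and \<open>w\<close> horizontal. In Rodrigues coordinates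
  $z = \tan(\theta/2)\,a$ geodesics are straight lines and the passage to the exponential chart at \<open>R\<close> is
  analytic, so this second derivative is continuous in \<open>(M, w)\<close>; at \<open>M = R\<close> it is the Hessian, which is
  positive on the compact horizontal unit sphere.
\<close>

section \<open>Rotations and unit quaternions\<close>

text \<open>The smoothness hypothesis and the Hessian live in the exponential chart centred at
  \<open>R\<close>, while a nearby geodesic starts at some other \<open>M\<close>. In that chart it
  reads log(exp z exp(t w)), which has no simple expression; this is the obstacle. Half-angle
  quaternions remove it: products become rational, and the only transcendental function left is
  arctan(sqrt s)/sqrt s, a power series in s, so the second-order data can be written down
  explicitly, smoothly through z = 0.

  Geodesics are given only metrically, so their smoothness has to be earned. The lift is based at a
  time slightly before the time of interest: one backward representative then fixes the direction of
  every forward one, and the resulting description covers a two-sided neighbourhood. Lengths are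
  kept below pi, where an additive angle forces the axes to agree.

  Lifts exist only at interior times, so convexity reaches the endpoints by continuity. The lift is
  close to \<open>R\<close> only up to a gauge rotation, which turns all velocities at once and
  hence keeps them horizontal.\<close>

text \<open>For a unit quaternion $q = w + z$ this is the matrix of $v \mapsto q v \bar q$;
  in general it is homogeneous of degree two in $(w,z)$.\<close>
definition quat_mat :: "real \<Rightarrow> real^3 \<Rightarrow> real^3^3" where
  "quat_mat w z = (w\<^sup>2 + z \<bullet> z) *\<^sub>R mat 1 + (2 * w) *\<^sub>R skew z + 2 *\<^sub>R (skew z ** skew z)"

lemma inner_3: "(x::real^3) \<bullet> y = x$1*y$1 + x$2*y$2 + x$3*y$3"
  by (simp add: inner_vec_def sum_3)

lemma mult_3: "((A::real^3^3) ** B) $ i $ j = A$i$1 * B$1$j + A$i$2 * B$2$j + A$i$3 * B$3$j"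
  by (simp add: matrix_matrix_mult_def sum_3)

text \<open>The arguments on the right are the scalar and vector part of the quaternion product. All
  later facts on composed rotations are read off from this homomorphism property.\<close>

lemma quat_mat_mult:
  "quat_mat v x ** quat_mat w y = quat_mat (v * w - x \<bullet> y) (v *\<^sub>R y + w *\<^sub>R x + cross3 x y)"
  by (simp add: vec_eq_iff forall_3 mult_3 quat_mat_def skew_entries cross3_def inner_3 mat_def
      power2_eq_square) (simp add: algebra_simps)

text \<open>For a unit quaternion this is 4w^2 - 1, so the cosine of the angle is 2w^2 - 1 and
  \<open>w\<close> is, up to sign, the cosine of half the angle.\<close>

lemma trace_quat_mat: "trace (quat_mat w z) = 3 * w\<^sup>2 - z \<bullet> z"
  by (simp add: trace_def sum_3 mult_3 quat_mat_def skew_entries inner_3 mat_def)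

lemma quat_mat_scale: "quat_mat (c * w) (c *\<^sub>R z) = c\<^sup>2 *\<^sub>R quat_mat w z"
  by (simp add: vec_eq_iff forall_3 mult_3 quat_mat_def skew_entries cross3_def inner_3 mat_def
      power2_eq_square algebra_simps)

lemma transpose_quat_mat: "transpose (quat_mat w z) = quat_mat w (- z)"
  by (simp add: vec_eq_iff forall_3 mult_3 quat_mat_def skew_entries cross3_def inner_3 mat_def
      transpose_def)

lemma quat_mat_one: "quat_mat 1 0 = mat 1"
  by (simp add: vec_eq_iff forall_3 mult_3 quat_mat_def skew_entries cross3_def inner_3 mat_def)

section \<open>Rodrigues' formula and one-parameter subgroups\<close>

lemma skew_power_even_odd:
  "((**) (skew v) ^^ Suc (2 * k)) (mat 1) = ((-1) ^ k * norm v ^ (2 * k)) *\<^sub>R skew v"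
  "((**) (skew v) ^^ Suc (Suc (2 * k))) (mat 1) = ((-1) ^ k * norm v ^ (2 * k)) *\<^sub>R (skew v ** skew v)"
proof -
  define M where "M k = ((**) (skew v) ^^ k) (mat 1)" for k
  have M0: "M 0 = mat 1" and MS: "M (Suc k) = skew v ** M k" for k
    by (simp_all add: M_def)
  have 1: "M (Suc (2 * k)) = ((-1) ^ k * norm v ^ (2 * k)) *\<^sub>R skew v" for k
  proof (induction k)
    case (Suc k)
    have "M (Suc (2 * Suc k)) = skew v ** (skew v ** (skew v ** M (2 * k)))"
      by (simp add: MS)
    also have "\<dots> = - ((norm v)\<^sup>2) *\<^sub>R M (Suc (2 * k))"
      by (simp add: skew_cube MS)
    finally show ?case unfolding Suc by (simp add: power2_eq_square)
  qed (simp add: MS M0)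
  then show "((**) (skew v) ^^ Suc (2 * k)) (mat 1) = ((-1) ^ k * norm v ^ (2 * k)) *\<^sub>R skew v"
    by (simp only: M_def)
  have "M (Suc (Suc (2 * k))) = ((-1) ^ k * norm v ^ (2 * k)) *\<^sub>R (skew v ** skew v)"
    unfolding MS[of "Suc (2 * k)"] 1 by (simp add: matrix_matrix_mult_def vec_eq_iff sum_distrib_left mult_ac)
  then show "((**) (skew v) ^^ Suc (Suc (2 * k))) (mat 1) = ((-1) ^ k * norm v ^ (2 * k)) *\<^sub>R (skew v ** skew v)"
    by (simp only: M_def)
qed

lemma skew_scaleR: "skew (t *\<^sub>R a) = t *\<^sub>R skew a"
  by (simp add: skew_entries vec_eq_iff forall_3)

text \<open>Rodrigues' formula, in terms of the half angle.\<close>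
lemma mat_exp_skew_unit:
  assumes a: "norm a = 1"
  shows "mat_exp (skew (t *\<^sub>R a)) = quat_mat (cos (t / 2)) (sin (t / 2) *\<^sub>R a)"
proof -
  define S where "S = skew a"
  \<comment> \<open>Powers of \<open>S\<close> reduce to \<open>S\<close> or \<open>S ** S\<close>
    up to sign, except the zeroth one. There the cosine term gives - \<open>S ** S\<close> instead
    of the identity, and the last summand repairs this.\<close>
  have coeffs: "(1 / fact k) *\<^sub>R (((**) (skew (t *\<^sub>R a)) ^^ k) (mat 1)) =
     (sin_coeff k * t ^ k) *\<^sub>R S - (cos_coeff k * t ^ k) *\<^sub>R (S ** S)
       + (if k = 0 then mat 1 + S ** S else 0)" for k
  proof -
    have ss: "(c *\<^sub>R S) ** (c *\<^sub>R S) = (c * c) *\<^sub>R (S ** S)" for c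
      by (simp add: matrix_matrix_mult_def vec_eq_iff sum_distrib_left mult_ac)
    have ab: "\<bar>t\<bar> ^ (2 * j) = t ^ (2 * j)" for j
      by (simp add: power_mult)
    consider "k = 0" | j where "k = Suc (Suc (2 * j))" | j where "k = Suc (2 * j)"
    proof (cases "even k")
      case True
      then obtain j where j: "k = 2 * j" by blast
      with that show thesis by (cases j) auto
    next
      case False
      then obtain j where "k = Suc (2 * j)" by (auto elim: oddE)
      with that show thesis by blast
    qed
    then show ?thesis
    proof cases
      case 1 then show ?thesis by simp
    next
      case (2 j)
      show ?thesis unfolding 2 skew_power_even_odd
        by (simp add: a skew_scaleR S_def[symmetric] ss cos_coeff_def sin_coeff_def ab del: fact_Suc)
    next
      case (3 j)
      show ?thesis unfolding 3 skew_power_even_odd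
        by (simp add: a skew_scaleR S_def[symmetric] ss cos_coeff_def sin_coeff_def ab del: fact_Suc)
    qed
  qed
  have s1: "(\<lambda>k. sin_coeff k * t ^ k) sums sin t" and s2: "(\<lambda>k. cos_coeff k * t ^ k) sums cos t"
    using sin_converges[of t] cos_converges[of t] by simp_all
  have "(\<lambda>k. (sin_coeff k * t ^ k) *\<^sub>R S - (cos_coeff k * t ^ k) *\<^sub>R (S ** S)
       + (if k = 0 then mat 1 + S ** S else 0)) sums (sin t *\<^sub>R S - cos t *\<^sub>R (S ** S) + (mat 1 + S ** S))"
    using s1 s2 sums_single[of 0 "\<lambda>_. mat 1 + S ** S"]
    by (intro sums_add sums_diff bounded_linear.sums[OF bounded_linear_scaleR_left]) simp_all
  moreover have "(\<lambda>k. (sin_coeff k * t ^ k) *\<^sub>R S - (cos_coeff k * t ^ k) *\<^sub>R (S ** S)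
       + (if k = 0 then mat 1 + S ** S else 0)) sums mat_exp (skew (t *\<^sub>R a))"
    using mat_exp_sums[of "skew (t *\<^sub>R a)"] by (simp only: coeffs)
  ultimately have e: "mat_exp (skew (t *\<^sub>R a)) = sin t *\<^sub>R S - cos t *\<^sub>R (S ** S) + (mat 1 + S ** S)"
    using sums_unique2 by blast
  have n: "a \<bullet> a = 1" using a by (simp add: norm_eq_1)
  have s: "sin t = 2 * cos (t/2) * sin (t/2)" "cos t = 1 - 2 * (sin (t/2))\<^sup>2"
    using sin_double[of "t/2"] cos_double_sin[of "t/2"] by simp_all
  have ss: "(c *\<^sub>R S) ** (c *\<^sub>R S) = (c * c) *\<^sub>R (S ** S)" for c
      by (simp add: matrix_matrix_mult_def vec_eq_iff sum_distrib_left mult_ac)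
  have m1: "(cos (t/2))\<^sup>2 + sin (t/2) * sin (t/2) = 1"
    using sin_cos_squared_add2[of "t/2"] by (simp add: power2_eq_square)
  have "quat_mat (cos (t / 2)) (sin (t / 2) *\<^sub>R a) = sin t *\<^sub>R S - cos t *\<^sub>R (S ** S) + (mat 1 + S ** S)"
    unfolding quat_mat_def skew_scaleR S_def[symmetric] ss
    by (simp add: n m1 s(1)) (simp add: s(2) power2_eq_square algebra_simps)
  with e show ?thesis by simp
qed

abbreviation rot :: "real^3 \<Rightarrow> real^3^3" where
  "rot x \<equiv> mat_exp (skew x)"

lemma unit_direction:
  obtains a :: "real^3" where "norm a = 1" "x = norm x *\<^sub>R a"
proof (cases "x = 0")
  case True
  then show ?thesis using that[of "axis 1 1"] by simp
next
  case False
  then show ?thesis using that[of "x /\<^sub>R norm x"] by simp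
qed

lemma rot_zero: "rot 0 = mat 1"
  using mat_exp_skew_unit[of "axis 1 1" 0] by (simp add: quat_mat_one)

text \<open>On a common axis the cross product in the quaternion product vanishes, and what remains
  are the addition formulas for the half angles.\<close>

lemma rot_add_mult: "rot (s *\<^sub>R x) ** rot (t *\<^sub>R x) = rot ((s + t) *\<^sub>R x)"
proof -
  obtain a where a: "norm a = 1" "x = norm x *\<^sub>R a" by (rule unit_direction)
  have n: "a \<bullet> a = 1" using a by (simp add: norm_eq_1)
  have *: "rot (s *\<^sub>R a) ** rot (t *\<^sub>R a) = rot ((s + t) *\<^sub>R a)" for s t
    unfolding mat_exp_skew_unit[OF a(1)] quat_mat_mult
    by (simp add: n cos_add sin_add add_divide_distrib cross_mult_left cross_mult_right
        mult.commute add.commute flip: scaleR_add_left)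
  have "r *\<^sub>R x = (r * norm x) *\<^sub>R a" for r
    by (metis a(2) scaleR_scaleR)
  then show ?thesis using *[of "s * norm x" "t * norm x"] by (simp add: distrib_right)
qed

lemma transpose_rot: "transpose (rot x) = rot (- x)"
proof -
  obtain a where a: "norm a = 1" "x = norm x *\<^sub>R a" by (rule unit_direction)
  have "transpose (rot (t *\<^sub>R a)) = rot (- t *\<^sub>R a)" for t
    unfolding mat_exp_skew_unit[OF a(1)] by (simp add: transpose_quat_mat)
  from this[of "norm x"] show ?thesis using a(2) by simp
qed

lemma rot_SO3: "rot x \<in> SO3"
proof -
  have o: "orthogonal_matrix (rot y)" for y
    using rot_add_mult[of "-1" y 1] rot_add_mult[of "1" y "-1"]
    by (simp add: orthogonal_matrix_def transpose_rot rot_zero)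
  \<comment> \<open>Orthogonality leaves the sign of the determinant open; it is positive because
    \<open>rot x\<close> is the square of the rotation by half the vector.\<close>
  have "det (rot x) = det (rot (x /\<^sub>R 2)) * det (rot (x /\<^sub>R 2))"
    using rot_add_mult[of "1/2" x "1/2"] by (simp flip: det_mul)
  moreover have "det (rot (x /\<^sub>R 2)) = 1 \<or> det (rot (x /\<^sub>R 2)) = -1"
    using o det_orthogonal_matrix by blast
  ultimately show ?thesis using o by (auto simp: SO3_def rotation_matrix_def)
qed

section \<open>Conjugation by rotations and surjectivity of the exponential map\<close>

lemma skew_conj:
  assumes "S \<in> SO3"
  shows "S ** skew x ** transpose S = skew (S *v x)"
proof -
  have "cross3 (S *v x) u = S *v cross3 x (transpose S *v u)" for u
    using cross_rotation_matrix[of S x "transpose S *v u"] assms SO3_cancel[OF assms]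
    by (simp add: SO3_def matrix_vector_mul_assoc del: transpose_matrix_vector)
  then have "(S ** skew x ** transpose S) *v u = skew (S *v x) *v u" for u
    by (simp add: skew_mult flip: matrix_vector_mul_assoc del: transpose_matrix_vector)
  then show ?thesis by (simp add: matrix_eq)
qed

lemma scaleR_mult_mat: "((c *\<^sub>R A) ** B :: real^3^3) = c *\<^sub>R (A ** B)"
  "(A ** (c *\<^sub>R B) :: real^3^3) = c *\<^sub>R (A ** B)"
  by (simp_all add: matrix_matrix_mult_def vec_eq_iff sum_distrib_left mult_ac)

lemma add_mult_mat: "(A + B) ** C = A ** C + B ** (C :: real^3^3)"
  by (simp add: matrix_matrix_mult_def vec_eq_iff distrib_right sum.distrib)

lemma quat_mat_conj:
  assumes S: "S \<in> SO3"
  shows "S ** quat_mat w z ** transpose S = quat_mat w (S *v z)"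
proof -
  have t: "orthogonal_transformation ((*v) S)"
    using S by (simp add: SO3_def rotation_matrix_def orthogonal_matrix_def orthogonal_transformation_matrix)
  have n: "(S *v z) \<bullet> (S *v z) = z \<bullet> z"
    using t by (simp add: orthogonal_transformation_def)
  have "skew (S *v z) ** skew (S *v z) = (S ** skew z ** transpose S) ** (S ** skew z ** transpose S)"
    by (simp add: skew_conj S)
  also have "\<dots> = S ** skew z ** (transpose S ** S) ** skew z ** transpose S"
    by (simp add: matrix_mul_assoc)
  also have "\<dots> = S ** (skew z ** skew z) ** transpose S"
    by (simp add: SO3_cancel[OF S] matrix_mul_assoc)
  finally show ?thesis
    by (simp add: quat_mat_def n scaleR_mult_mat matrix_add_ldistrib add_mult_mat 
       SO3_cancel[OF S] skew_conj[OF S] matrix_mul_assoc)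
qed

lemma rot_conj:
  assumes S: "S \<in> SO3"
  shows "S ** rot x ** transpose S = rot (S *v x)"
proof -
  obtain a where a: "norm a = 1" "x = norm x *\<^sub>R a" by (rule unit_direction)
  have t: "orthogonal_transformation ((*v) S)"
    using S by (simp add: SO3_def rotation_matrix_def orthogonal_matrix_def orthogonal_transformation_matrix)
  have n: "norm (S *v a) = 1"
    using t a by (simp add: orthogonal_transformation_norm)
  have "S ** rot (s *\<^sub>R a) ** transpose S = rot (S *v (s *\<^sub>R a))" for s
    using mat_exp_skew_unit[OF n, of s] quat_mat_conj[OF S]
    by (simp add: mat_exp_skew_unit[OF a(1)] matrix_vector_mult_scaleR)
  from this[of "norm x"] a(2) show ?thesis by simp
qed

text \<open>Euler's theorem. A - 1 = A(1 - A^T) has the determinant of 1 - A, which in odd dimension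
  is minus that of A - 1; so A - 1 is singular.\<close>

lemma SO3_fixed_axis:
  assumes A: "A \<in> SO3"
  obtains u where "norm u = 1" "A *v u = u"
proof -
  have neg: "det (- B) = - det B" for B :: "real^3^3"
    by (simp add: det_3)
  have "A ** (B - C) = A ** B - A ** C" for B C :: "real^3^3"
    by (simp add: matrix_matrix_mult_def vec_eq_iff right_diff_distrib sum_subtractf)
  then have "det (A - mat 1) = det (A ** (mat 1 - transpose A))"
    by (simp add: SO3_cancel[OF A])
  also have "\<dots> = det (transpose (mat 1 - transpose A))"
    using A by (simp add: det_mul SO3_def rotation_matrix_def)
  also have "transpose (mat 1 - transpose A) = - (A - mat 1)"
    by (simp add: transpose_def vec_eq_iff mat_def)
  also have "det (- (A - mat 1)) = - det (A - mat 1)"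
    using neg by blast
  finally have "det (A - mat 1) = 0" by simp
  then have "\<not> invertible (A - mat 1)" by (simp add: invertible_det_nz)
  then obtain x where x: "x \<noteq> 0" "(A - mat 1) *v x = 0"
    by (metis invertible_left_inverse matrix_left_invertible_ker)
  then have "A *v x = x" by (simp add: matrix_vector_mult_diff_rdistrib)
  with x(1) show ?thesis
    by (intro that[of "x /\<^sub>R norm x"]) (simp_all add: matrix_vector_mult_scaleR)
qed

lemma SO3_fix_e1:
  assumes A: "A \<in> SO3" and f: "A *v axis 1 1 = axis 1 1"
  obtains t where "\<bar>t\<bar> \<le> pi" "A = rot (t *\<^sub>R axis 1 1)"
proof -
  have c: "A$1$1 = 1" "A$2$1 = 0" "A$3$1 = 0"
    using f by (simp_all add: matrix_vector_mult_def vec_eq_iff forall_3 sum_3 axis_def)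
  have o: "A ** transpose A = mat 1" "transpose A ** A = mat 1" using SO3_cancel[OF A] by auto
  \<comment> \<open>The first row is a unit vector whose first entry is already 1; the remaining 2
    by 2 block is then a planar rotation.\<close>
  have r: "(A$1$2)\<^sup>2 + (A$1$3)\<^sup>2 = 0"
    using arg_cong[OF o(1), of "\<lambda>B. B$1$1"] c by (simp add: mult_3 transpose_def mat_def power2_eq_square)
  then have r12: "A$1$2 = 0" "A$1$3 = 0" by (auto simp: sum_power2_eq_zero_iff)
  have e1: "(A$2$2)\<^sup>2 + (A$3$2)\<^sup>2 = 1"
    using arg_cong[OF o(2), of "\<lambda>B. B$2$2"] c r12 by (simp add: mult_3 transpose_def mat_def power2_eq_square)
  have e2: "A$2$2 * A$2$3 + A$3$2 * A$3$3 = 0"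
    using arg_cong[OF o(2), of "\<lambda>B. B$2$3"] c r12 by (simp add: mult_3 transpose_def mat_def power2_eq_square)
  have e3: "A$2$2 * A$3$3 - A$2$3 * A$3$2 = 1"
    using A c r12 by (simp add: SO3_def rotation_matrix_def det_3)
  have e4: "A$3$3 = A$2$2" "A$2$3 = - A$3$2"
    using e1 e2 e3 by algebra+
  obtain t0 where t0: "A$2$2 = cos t0" "A$3$2 = sin t0" "0 \<le> t0" "t0 < 2 * pi"
    using sincos_total_2pi[OF e1] by metis
  \<comment> \<open>Moves the angle from [0, 2 pi) to (-pi, pi], so that the vector found has norm
    at most pi.\<close>
  define t where "t = (if t0 \<le> pi then t0 else t0 - 2 * pi)"
  have t: "A$2$2 = cos t" "A$3$2 = sin t" "\<bar>t\<bar> \<le> pi"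
    using t0 by (auto simp: t_def cos_diff sin_diff)
  have h: "cos t = (cos (t/2))\<^sup>2 - (sin (t/2))\<^sup>2" "sin t = 2 * sin (t/2) * cos (t/2)"
    using sin_double[of "t/2"] cos_double[of "t/2"] by simp_all
  have h1: "sin (t / 2) * sin (t / 2) + cos (t / 2) * cos (t / 2) = 1"
    using sin_cos_squared_add[of "t/2"] by (simp add: power2_eq_square)
  have "A = quat_mat (cos (t/2)) (sin (t/2) *\<^sub>R axis 1 1)"
    using h h1 by (simp add: vec_eq_iff forall_3 mult_3 quat_mat_def skew_entries
        inner_3 mat_def axis_def c r12 e4 t power2_eq_square)
  then have "A = rot (t *\<^sub>R axis 1 1)" by (simp add: mat_exp_skew_unit)
  with t(3) that show ?thesis by blast
qed

text \<open>A rotation \<open>Q\<close> taking the first basis vector to the fixed axis conjugates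
  \<open>A\<close> into the case \<open>SO3_fix_e1\<close>; \<open>rot_conj\<close> carries the
  result back.\<close>

lemma SO3_eq_rot:
  assumes A: "A \<in> SO3"
  obtains x where "norm x \<le> pi" "A = rot x"
proof -
  obtain u where u: "norm u = 1" "A *v u = u" using SO3_fixed_axis[OF A] .
  obtain Q where Q: "rotation_matrix Q" "Q *v axis 1 1 = u"
    using rotation_matrix_exists_basis[of u 1] u by auto
  then have QS: "Q \<in> SO3" by (simp add: SO3_def)
  define B where "B = transpose Q ** A ** Q"
  have B: "B \<in> SO3" unfolding B_def using A QS by (intro SO3_mult SO3_transpose)
  have "B *v axis 1 1 = transpose Q *v u"
    by (simp add: B_def Q u flip: matrix_vector_mul_assoc)
  also have "\<dots> = axis 1 1"
    unfolding Q(2)[symmetric] by (simp add: matrix_vector_mul_assoc SO3_cancel[OF QS])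
  finally obtain t where t: "\<bar>t\<bar> \<le> pi" "B = rot (t *\<^sub>R axis 1 1)"
    using SO3_fix_e1[OF B] by blast
  have "Q ** B ** transpose Q = (Q ** transpose Q) ** A ** (Q ** transpose Q)"
    by (simp add: B_def matrix_mul_assoc)
  then have "A = Q ** B ** transpose Q" by (simp add: SO3_cancel[OF QS])
  also have "\<dots> = rot (t *\<^sub>R u)"
    unfolding t(2) rot_conj[OF QS] by (simp add: matrix_vector_mult_scaleR Q)
  finally show ?thesis using t(1) u by (intro that[of "t *\<^sub>R u"]) auto
qed

section \<open>Geodesics in the quotient\<close>

lemma quat_norm_mult:
  "(v * w - x \<bullet> y)\<^sup>2 + (v *\<^sub>R y + w *\<^sub>R x + cross3 x y) \<bullet> (v *\<^sub>R y + w *\<^sub>R x + cross3 x y) =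
     (v\<^sup>2 + x \<bullet> x) * (w\<^sup>2 + y \<bullet> y)"
proof -
  have c: "cross3 x y \<bullet> cross3 x y = (x \<bullet> x) * (y \<bullet> y) - (x \<bullet> y)\<^sup>2"
    using norm_cross[of x y] by (simp add: power2_norm_eq_inner)
  show ?thesis
    by (simp add: inner_add_left inner_add_right c dot_cross_self inner_commute[of y x] power2_eq_square algebra_simps)
qed

text \<open>The half-angle form of the spherical law of cosines.\<close>
lemma rotation_angle_rot_mult:
  assumes a: "norm a = 1" and b: "norm b = 1"
    and q: "q = cos (s/2) * cos (t/2) - (a \<bullet> b) * sin (s/2) * sin (t/2)"
  shows "rotation_angle (rot (s *\<^sub>R a) ** rot (t *\<^sub>R b)) = arccos (2 * q\<^sup>2 - 1)" and "q\<^sup>2 \<le> 1"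
proof -
  define V where "V = cos (s/2) *\<^sub>R (sin (t/2) *\<^sub>R b) + cos (t/2) *\<^sub>R (sin (s/2) *\<^sub>R a)
     + cross3 (sin (s/2) *\<^sub>R a) (sin (t/2) *\<^sub>R b)"
  have q': "q = cos (s/2) * cos (t/2) - (sin (s/2) *\<^sub>R a) \<bullet> (sin (t/2) *\<^sub>R b)"
    by (simp add: q)
  have ab: "a \<bullet> a = 1" "b \<bullet> b = 1" using a b by (simp_all add: norm_eq_1)
  have "q\<^sup>2 + V \<bullet> V = 1"
    unfolding V_def q' quat_norm_mult by (simp add: ab flip: power2_eq_square)
  then have n: "V \<bullet> V = 1 - q\<^sup>2" by simp
  then show "q\<^sup>2 \<le> 1" using inner_ge_zero[of V] by linarith
  have "rot (s *\<^sub>R a) ** rot (t *\<^sub>R b) = quat_mat q V"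
    unfolding V_def q' mat_exp_skew_unit[OF a] mat_exp_skew_unit[OF b] quat_mat_mult ..
  then show "rotation_angle (rot (s *\<^sub>R a) ** rot (t *\<^sub>R b)) = arccos (2 * q\<^sup>2 - 1)"
    by (simp add: rotation_angle_def trace_quat_mat n diff_divide_distrib)
qed

lemma cos_half_angle: "cos x = 2 * (cos (x / 2))\<^sup>2 - (1 :: real)"
  using cos_double_cos[of "x / 2"] by simp

text \<open>All rests on q - cos((s+t)/2) = (1 - a.b) sin(s/2) sin(t/2), whose right side is
  nonnegative. Its sign gives the triangle inequality, its vanishing the equality case.\<close>

lemma cos_add_half:
  assumes "0 \<le> s" "0 \<le> t" "s + t \<le> pi" and "norm a = 1" "norm b = 1"
    and q: "q = cos (s/2) * cos (t/2) - (a \<bullet> b) * sin (s/2) * sin (t/2)"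
  shows "cos ((s + t) / 2) \<le> q" "0 \<le> cos ((s + t) / 2)"
    and "q = cos ((s + t) / 2) \<longleftrightarrow> (1 - a \<bullet> b) * (sin (s/2) * sin (t/2)) = 0"
proof -
  have e: "q - cos ((s + t) / 2) = (1 - a \<bullet> b) * (sin (s/2) * sin (t/2))"
    by (simp add: q add_divide_distrib cos_add algebra_simps)
  have "a \<bullet> b \<le> 1" using norm_cauchy_schwarz[of a b] assms by simp
  moreover have "0 \<le> sin (s/2) * sin (t/2)"
    using assms by (intro mult_nonneg_nonneg sin_ge_zero) auto
  ultimately have "0 \<le> (1 - a \<bullet> b) * (sin (s/2) * sin (t/2))" by simp
  with e show "cos ((s + t) / 2) \<le> q" by linarith
  show "0 \<le> cos ((s + t) / 2)" using assms by (intro cos_ge_zero) auto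
  show "q = cos ((s + t) / 2) \<longleftrightarrow> (1 - a \<bullet> b) * (sin (s/2) * sin (t/2)) = 0"
    using e by linarith
qed

text \<open>The composed angle arccos(2q^2 - 1) decreases in q^2, and \<open>q\<close> is at least
  cos((s+t)/2), which is nonnegative. If s + t exceeds pi, the bound is trivial since arccos never
  does.\<close>

lemma rotation_angle_mult_le:
  "rotation_angle (rot u ** rot v) \<le> norm u + norm v"
proof -
  obtain a where a: "norm a = 1" "u = norm u *\<^sub>R a" by (rule unit_direction)
  obtain b where b: "norm b = 1" "v = norm v *\<^sub>R b" by (rule unit_direction)
  define s t where "s = norm u" and "t = norm v"
  define q where "q = cos (s/2) * cos (t/2) - (a \<bullet> b) * sin (s/2) * sin (t/2)"
  have ang: "rotation_angle (rot u ** rot v) = arccos (2 * q\<^sup>2 - 1)" and q1: "q\<^sup>2 \<le> 1"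
    using rotation_angle_rot_mult[OF a(1) b(1) q_def] a(2) b(2) by (simp_all add: s_def t_def)
  show ?thesis
  proof (cases "s + t \<le> pi")
    case True
    have st: "0 \<le> s" "0 \<le> t" by (simp_all add: s_def t_def)
    have "(cos ((s + t) / 2))\<^sup>2 \<le> q\<^sup>2"
      using cos_add_half(1,2)[OF st True a(1) b(1) q_def] by (rule power_mono)
    then have "cos (s + t) \<le> 2 * q\<^sup>2 - 1"
      using cos_half_angle[of "s + t"] by simp
    then have "arccos (2 * q\<^sup>2 - 1) \<le> arccos (cos (s + t))"
      using q1 by (intro arccos_le_arccos) auto
    also have "\<dots> = s + t" using st True by (intro arccos_cos) auto
    finally show ?thesis by (simp add: ang s_def t_def)
  next
    case False
    have "arccos (2 * q\<^sup>2 - 1) \<le> pi" using q1 by (intro arccos_ubound) auto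
    with False show ?thesis by (simp add: ang s_def t_def)
  qed
qed

text \<open>Equality forces q = cos((s+t)/2), so the axes agree or one rotation is trivial. The
  cross-multiplied conclusion covers both cases.\<close>

lemma rotation_angle_mult_eqD:
  assumes lt: "norm u + norm v < pi" and eq: "rotation_angle (rot u ** rot v) = norm u + norm v"
  shows "norm u *\<^sub>R v = norm v *\<^sub>R u"
proof -
  obtain a where a: "norm a = 1" "u = norm u *\<^sub>R a" by (rule unit_direction)
  obtain b where b: "norm b = 1" "v = norm v *\<^sub>R b" by (rule unit_direction)
  define s t where "s = norm u" and "t = norm v"
  define q where "q = cos (s/2) * cos (t/2) - (a \<bullet> b) * sin (s/2) * sin (t/2)"
  have st: "0 \<le> s" "0 \<le> t" "s + t \<le> pi" using lt by (simp_all add: s_def t_def)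
  have ang: "arccos (2 * q\<^sup>2 - 1) = s + t" and q1: "q\<^sup>2 \<le> 1"
    using rotation_angle_rot_mult[OF a(1) b(1) q_def] a(2) b(2) eq by (simp_all add: s_def t_def)
  have "2 * q\<^sup>2 - 1 = cos (s + t)"
    using q1 by (simp flip: ang add: cos_arccos)
  then have "q\<^sup>2 = (cos ((s + t) / 2))\<^sup>2"
    using cos_half_angle[of "s + t"] by simp
  then have "q = cos ((s + t) / 2)"
    using order_trans[OF cos_add_half(2,1)[OF st a(1) b(1) q_def]] cos_add_half(2)[OF st a(1) b(1) q_def]
    by (rule power2_eq_imp_eq)
  then have "(1 - a \<bullet> b) * (sin (s/2) * sin (t/2)) = 0"
    using cos_add_half(3)[OF st a(1) b(1) q_def] by simp
  moreover have "sin (s/2) > 0" if "s \<noteq> 0" using that st pi_gt_zero by (intro sin_gt_zero) linarith+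
  moreover have "sin (t/2) > 0" if "t \<noteq> 0" using that st pi_gt_zero by (intro sin_gt_zero) linarith+
  ultimately consider "s = 0" | "t = 0" | "a \<bullet> b = 1" by force
  then show ?thesis
  proof cases
    case 3
    then have "a = b"
      using norm_cauchy_schwarz_eq[of a b] a b by simp
    then show ?thesis using a(2) b(2) by (metis scaleR_scaleR mult.commute)
  qed (simp_all add: s_def t_def)
qed

section \<open>Minimal geodesics between configurations\<close>

lemma SO3_eq_rot_angle:
  assumes "A \<in> SO3"
  obtains x where "norm x \<le> pi" "norm x = rotation_angle A" "A = rot x"
  using SO3_eq_rot[OF assms] rotation_angle_exp_skew by metis

lemma SO3_trace_bounds:
  assumes "A \<in> SO3"
  shows "- 1 \<le> (trace A - 1) / 2" "(trace A - 1) / 2 \<le> 1"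
proof -
  obtain x where "A = rot x" using SO3_eq_rot[OF assms] by blast
  then have "(trace A - 1) / 2 = cos (norm x)" by (simp add: trace_exp_skew)
  then show "- 1 \<le> (trace A - 1) / 2" "(trace A - 1) / 2 \<le> 1" by auto
qed

lemma rotation_angle_nonneg: "A \<in> SO3 \<Longrightarrow> 0 \<le> rotation_angle A"
  unfolding rotation_angle_def by (intro arccos_lbound SO3_trace_bounds)

lemma config_exp_SO3n: "P \<in> SO3n \<Longrightarrow> config_exp P x \<in> SO3n"
  by (simp add: SO3n_def config_exp_def SO3_mult rot_SO3)

lemma config_exp_zero: "config_exp P 0 = P"
  by (simp add: config_exp_def rot_zero vec_eq_iff)

lemma config_exp_add: "config_exp (config_exp P (s *\<^sub>R x)) (t *\<^sub>R x) = config_exp P ((s + t) *\<^sub>R x)"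
  by (simp add: config_exp_def rot_add_mult flip: matrix_mul_assoc)

text \<open>Velocities are measured in the body frame, so passing to the representative moved by
  \<open>S\<close> turns every component by the same rotation.\<close>

lemma gauge_act_config_exp:
  assumes S: "S \<in> SO3"
  shows "gauge_act (config_exp P x) S = config_exp (gauge_act P S) (\<chi> i. transpose S *v x $ i)"
proof -
  have "A ** rot y ** S = A ** S ** rot (transpose S *v y)" for A :: "real^3^3" and y
  proof -
    have "rot (transpose S *v y) = transpose S ** rot y ** S"
      using rot_conj[OF SO3_transpose[OF S], of y] by (simp only: transpose_transpose)
    then have "A ** S ** rot (transpose S *v y) = A ** (S ** transpose S) ** rot y ** S"
      by (simp only: matrix_mul_assoc)
    then show ?thesis by (simp add: SO3_cancel[OF S])
  qed
  then show ?thesis by (simp add: gauge_act_def config_exp_def del: transpose_matrix_vector)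
qed

text \<open>\<open>M\<close> lies between the two ends, reached backwards along \<open>u\<close> and
  forwards along \<open>v\<close>; in each factor the displacement from end to end is the product of
  the two rotations.\<close>

lemma config_dist_exp_exp:
  assumes "M \<in> SO3n"
  shows "config_dist (config_exp M (- u)) (config_exp M v) =
    norm (\<chi> i. rotation_angle (rot (u $ i) ** rot (v $ i)))"
proof -
  have "rot_dist (M $ i ** rot (- x)) (M $ i ** rot y) = rotation_angle (rot x ** rot y)" for i x y
  proof -
    have "M $ i \<in> SO3" using assms by (simp add: SO3n_def)
    then have "rot x ** transpose (M $ i) ** (M $ i ** rot y) = rot x ** rot y"
      by (metis SO3_cancel(1) matrix_mul_assoc matrix_mul_rid)
    then show ?thesis by (simp add: rot_dist_def matrix_transpose_mul transpose_rot)
  qed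
  then show ?thesis
    by (simp add: config_dist_def config_exp_def norm_vec_def L2_set_def)
qed

lemma config_eq_exp:
  assumes P: "P \<in> SO3n" and Q: "Q \<in> SO3n"
  obtains x where "Q = config_exp P x" "config_dist P Q = norm x" "\<And>i. norm (x $ i) = rot_dist (P $ i) (Q $ i)"
proof -
  have "\<exists>y. norm y = rot_dist (P $ i) (Q $ i) \<and> Q $ i = P $ i ** rot y" for i
  proof -
    have PQ: "P $ i \<in> SO3" "Q $ i \<in> SO3" using P Q by (simp_all add: SO3n_def)
    then have "transpose (P $ i) ** Q $ i \<in> SO3" by (intro SO3_mult SO3_transpose)
    then obtain y where y: "norm y = rotation_angle (transpose (P $ i) ** Q $ i)" "transpose (P $ i) ** Q $ i = rot y"
      by (rule SO3_eq_rot_angle)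
    have "P $ i ** (transpose (P $ i) ** Q $ i) = Q $ i"
      by (simp add: matrix_mul_assoc SO3_cancel PQ)
    with y show ?thesis unfolding rot_dist_def by metis
  qed
  then obtain f where f: "norm (f i) = rot_dist (P $ i) (Q $ i)" "Q $ i = P $ i ** rot (f i)" for i
    by metis
  show ?thesis
    by (rule that[of "\<chi> i. f i"])
      (simp_all add: config_exp_def vec_eq_iff config_dist_def norm_vec_def L2_set_def flip: f)
qed

text \<open>In norms of the vectors of angles: |\<alpha>| + |\<beta>| \<le> |c| \<le> |\<alpha> +
  \<beta>| \<le> |\<alpha>| + |\<beta>|, so all are equal. The last equality makes the factorwise
  speeds proportional, the middle one makes every factor an equality case of the triangle
  inequality, which aligns the axes.\<close>

lemma config_geodesic_unique:
  assumes M: "M \<in> SO3n" and lt: "norm u + norm v < pi"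
    and ge: "norm u + norm v \<le> config_dist (config_exp M (- u)) (config_exp M v)"
  shows "norm u *\<^sub>R v = norm v *\<^sub>R u"
proof -
  define \<alpha> \<beta> c where "\<alpha> = (\<chi> i. norm (u $ i))" and "\<beta> = (\<chi> i. norm (v $ i))"
    and "c = (\<chi> i. rotation_angle (rot (u $ i) ** rot (v $ i)))"
  have n: "norm \<alpha> = norm u" "norm \<beta> = norm v"
    by (simp_all add: \<alpha>_def \<beta>_def norm_vec_def)
  have ci: "0 \<le> c $ i" "c $ i \<le> (\<alpha> + \<beta>) $ i" for i
  proof -
    have "rot (u $ i) ** rot (v $ i) \<in> SO3" by (intro SO3_mult rot_SO3)
    then show "0 \<le> c $ i" by (simp add: c_def rotation_angle_nonneg)
    show "c $ i \<le> (\<alpha> + \<beta>) $ i" by (simp add: c_def \<alpha>_def \<beta>_def rotation_angle_mult_le)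
  qed
  have le: "norm \<alpha> + norm \<beta> \<le> norm c"
    using ge by (simp add: n config_dist_exp_exp[OF M] c_def)
  have sq: "(c $ i)\<^sup>2 \<le> ((\<alpha> + \<beta>) $ i)\<^sup>2" for i
    using ci by (intro power_mono)
  have c_le: "norm c \<le> norm (\<alpha> + \<beta>)"
    unfolding norm_vec_def L2_set_def using sq by (intro real_sqrt_le_mono sum_mono) simp
  have eq1: "norm (\<alpha> + \<beta>) = norm \<alpha> + norm \<beta>" and eq2: "norm c = norm (\<alpha> + \<beta>)"
    using le c_le norm_triangle_ineq[of \<alpha> \<beta>] by linarith+
  have par: "norm \<alpha> *\<^sub>R \<beta> = norm \<beta> *\<^sub>R \<alpha>"
    using eq1 by (simp add: norm_triangle_eq)
  have "(\<Sum>i\<in>UNIV. (c $ i)\<^sup>2) = (\<Sum>i\<in>UNIV. ((\<alpha> + \<beta>) $ i)\<^sup>2)"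
    using eq2 by (simp add: norm_vec_def L2_set_def)
  \<comment> \<open>A sum of nonnegative differences that vanishes: equality of the norms passes to
    each component.\<close>
  then have "(\<Sum>i\<in>UNIV. ((\<alpha> + \<beta>) $ i)\<^sup>2 - (c $ i)\<^sup>2) = 0"
    by (simp add: sum_subtractf)
  then have "((\<alpha> + \<beta>) $ i)\<^sup>2 - (c $ i)\<^sup>2 = 0" for i
    using sq by (subst (asm) sum_nonneg_eq_0_iff) auto
  then have "((\<alpha> + \<beta>) $ i)\<^sup>2 = (c $ i)\<^sup>2" for i by simp
  then have ceq: "c $ i = norm (u $ i) + norm (v $ i)" for i
    using power2_eq_imp_eq[of "(\<alpha> + \<beta>) $ i" "c $ i"] ci[of i] by (simp add: \<alpha>_def \<beta>_def)
  have "norm u *\<^sub>R v $ i = norm v *\<^sub>R u $ i" for i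
  proof -
    have "norm (u $ i) + norm (v $ i) < pi"
      using Finite_Cartesian_Product.norm_nth_le[of u i] Finite_Cartesian_Product.norm_nth_le[of v i] lt by linarith
    then have *: "norm (u $ i) *\<^sub>R v $ i = norm (v $ i) *\<^sub>R u $ i"
      using ceq[of i] by (intro rotation_angle_mult_eqD) (simp_all add: c_def)
    have p: "norm u * norm (v $ i) = norm v * norm (u $ i)"
      using arg_cong[OF par, of "\<lambda>x. x $ i"] by (simp add: n) (simp add: \<alpha>_def \<beta>_def)
    show ?thesis
    proof (cases "u $ i = 0")
      case True
      with p have "u = 0 \<or> v $ i = 0" by auto
      with True show ?thesis by auto
    next
      case False
      have "norm (u $ i) *\<^sub>R (norm u *\<^sub>R v $ i) = norm u *\<^sub>R (norm (u $ i) *\<^sub>R v $ i)"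
        by simp
      also have "\<dots> = (norm u * norm (v $ i)) *\<^sub>R u $ i" by (simp add: *)
      also have "\<dots> = norm (u $ i) *\<^sub>R (norm v *\<^sub>R u $ i)" by (simp add: p)
      finally show ?thesis
        using False by (simp del: scaleR_scaleR)
    qed
  qed
  then show ?thesis by (simp add: vec_eq_iff)
qed

section \<open>First variation of the squared distance along the gauge orbit\<close>

lemma arccos_half_angle:
  assumes "0 \<le> q" "q \<le> 1"
  shows "arccos (2 * q\<^sup>2 - 1) = 2 * arccos q"
proof -
  have "arccos q \<le> pi / 2" using assms arccos_le_pi2 by auto
  moreover have "0 \<le> arccos q" using assms by (intro arccos_lbound) auto
  moreover have "cos (2 * arccos q) = 2 * q\<^sup>2 - 1"
    using assms by (simp add: cos_double_cos cos_arccos)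
  ultimately show ?thesis using arccos_cos[of "2 * arccos q"] by simp
qed

text \<open>The square makes the function differentiable also at \<open>u = 0\<close>, where the
  angle itself is |s| and arccos would be taken at its singular end; that case is separate.
  Otherwise \<open>q\<close> stays strictly between 0 and 1 near 0, and the angle is 2 arccos q
  there.\<close>

lemma DERIV_rotation_angle_sq:
  assumes u: "norm u < pi" and b: "norm b = 1"
  shows "((\<lambda>s. (rotation_angle (rot u ** rot (s *\<^sub>R b)))\<^sup>2) has_real_derivative 2 * (u \<bullet> b)) (at 0)"
proof (cases "u = 0")
  case True
  have "((\<lambda>s::real. s\<^sup>2) has_real_derivative 0) (at 0)"
    by (auto intro!: derivative_eq_intros)
  moreover have "\<forall>\<^sub>F s in nhds 0. s \<in> {-pi<..<pi}"
    by (intro eventually_nhds_in_open) auto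
  then have "\<forall>\<^sub>F s in nhds 0. (rotation_angle (rot u ** rot (s *\<^sub>R b)))\<^sup>2 = s\<^sup>2"
  proof eventually_elim
    case (elim s)
    then have "\<bar>s\<bar> \<le> pi" by auto
    then show ?case using rotation_angle_exp_skew[of "s *\<^sub>R b"] by (simp add: True rot_zero b)
  qed
  ultimately show ?thesis by (subst DERIV_cong_ev[OF refl _ refl]) (simp_all add: True)
next
  case False
  obtain a where a: "norm a = 1" "u = norm u *\<^sub>R a" by (rule unit_direction)
  define \<alpha> where "\<alpha> = norm u"
  have \<alpha>: "0 < \<alpha>" "\<alpha> < pi" "u = \<alpha> *\<^sub>R a" using False u a(2) by (simp_all add: \<alpha>_def)
  define q where "q s = cos (\<alpha>/2) * cos (s/2) - (a \<bullet> b) * sin (\<alpha>/2) * sin (s/2)" for s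
  have q0: "q 0 = cos (\<alpha>/2)" by (simp add: q_def)
  have r: "0 < cos (\<alpha>/2)" "cos (\<alpha>/2) < 1" "0 < sin (\<alpha>/2)"
    using \<alpha> cos_gt_zero_pi[of "\<alpha>/2"] cos_monotone_0_pi[of 0 "\<alpha>/2"] by (auto intro: sin_gt_zero)
  have dq: "(q has_real_derivative - (a \<bullet> b) * sin (\<alpha>/2) / 2) (at 0)"
    unfolding q_def by (auto intro!: derivative_eq_intros)
  have "isCont q 0" using dq by (rule DERIV_isCont)
  then have "\<forall>\<^sub>F s in nhds 0. q s \<in> {0<..<1}"
    using r unfolding isCont_def tendsto_at_iff_tendsto_nhds
    by (intro topological_tendstoD[of q "q 0"]) (auto simp: q0)
  then have ev: "\<forall>\<^sub>F s in nhds 0. (rotation_angle (rot u ** rot (s *\<^sub>R b)))\<^sup>2 = (2 * arccos (q s))\<^sup>2"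
  proof eventually_elim
    case (elim s)
    then have "rotation_angle (rot u ** rot (s *\<^sub>R b)) = 2 * arccos (q s)"
      unfolding \<alpha>(3) rotation_angle_rot_mult(1)[OF a(1) b q_def] by (intro arccos_half_angle) auto
    then show ?case by simp
  qed
  have sc: "sqrt (1 - (cos (\<alpha>/2))\<^sup>2) = sin (\<alpha>/2)"
    using r(3) by (simp flip: sin_squared_eq)
  have "((\<lambda>s. arccos (q s)) has_real_derivative (a \<bullet> b) / 2) (at 0)"
  proof -
    have "(arccos has_real_derivative inverse (- sqrt (1 - (q 0)\<^sup>2))) (at (q 0))"
      by (rule DERIV_arccos) (use r in \<open>simp_all add: q0\<close>)
    moreover have "inverse (- sqrt (1 - (q 0)\<^sup>2)) * (- (a \<bullet> b) * sin (\<alpha>/2) / 2) = (a \<bullet> b) / 2"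
      unfolding q0 sc using r(3) by (simp add: inverse_eq_divide)
    ultimately show ?thesis using DERIV_chain2[OF _ dq] by metis
  qed
  then have d: "((\<lambda>s. (2 * arccos (q s))\<^sup>2) has_real_derivative
      of_nat 2 * (2 * ((a \<bullet> b) / 2) * (2 * arccos (q 0)) ^ (2 - Suc 0))) (at 0)"
    by (intro DERIV_power DERIV_cmult)
  have "arccos (q 0) = \<alpha> / 2" unfolding q0 using \<alpha>(1,2) by (intro arccos_cos) auto
  then have "of_nat 2 * (2 * ((a \<bullet> b) / 2) * (2 * arccos (q 0)) ^ (2 - Suc 0)) = 2 * (u \<bullet> b)"
    unfolding \<alpha>(3) by simp
  with d have "((\<lambda>s. (2 * arccos (q s))\<^sup>2) has_real_derivative 2 * (u \<bullet> b)) (at 0)"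
    by (rule DERIV_cong)
  then show ?thesis by (subst DERIV_cong_ev[OF refl ev refl])
qed

lemma orthogonal_comp_vertical_iff:
  "u \<in> orthogonal_comp vertical_space \<longleftrightarrow> (\<forall>v. (\<Sum>i\<in>UNIV. u $ i \<bullet> v) = 0)"
proof -
  have "(\<chi> i. v) \<bullet> u = (\<Sum>i\<in>UNIV. u $ i \<bullet> v)" for v
    by (subst inner_vec_def) (simp add: inner_commute)
  then show ?thesis by (auto simp: orthogonal_comp_def vertical_space_def orthogonal_def)
qed

text \<open>First variation: along the gauge orbit the squared distance has derivative
  twice the inner product with the vertical direction.\<close>
lemma minimizing_imp_horizontal:
  assumes M: "M \<in> SO3n" and u: "\<And>i. norm (u $ i) < pi"
    and min: "\<And>S. S \<in> SO3 \<Longrightarrow> config_dist (config_exp M (- u)) M \<le> config_dist (config_exp M (- u)) (gauge_act M S)"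
  shows "u \<in> orthogonal_comp vertical_space"
proof -
  have unit: "(\<Sum>i\<in>UNIV. u $ i \<bullet> b) = 0" if b: "norm b = 1" for b
  proof -
    define \<Phi> where "\<Phi> s = (\<Sum>i\<in>UNIV. (rotation_angle (rot (u $ i) ** rot (s *\<^sub>R b)))\<^sup>2)" for s
    have d: "(\<Phi> has_real_derivative (\<Sum>i\<in>UNIV. 2 * (u $ i \<bullet> b))) (at 0)"
      unfolding \<Phi>_def by (intro DERIV_sum DERIV_rotation_angle_sq u b)
    \<comment> \<open>A gauge move by a one-parameter subgroup gives every factor the same velocity,
      that is, a vertical one.\<close>
    have g: "gauge_act M (rot (s *\<^sub>R b)) = config_exp M (\<chi> i. s *\<^sub>R b)" for s
      by (simp add: gauge_act_def config_exp_def)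
    have "config_dist (config_exp M (- u)) (gauge_act M (rot (s *\<^sub>R b))) = sqrt (\<Phi> s)" for s
      by (simp add: g config_dist_exp_exp[OF M] \<Phi>_def norm_vec_def L2_set_def)
    moreover from this[of 0] have "config_dist (config_exp M (- u)) M = sqrt (\<Phi> 0)"
      by (simp add: rot_zero gauge_act_one)
    ultimately have "\<Phi> 0 \<le> \<Phi> s" for s
      using min[OF rot_SO3[of "s *\<^sub>R b"]] by simp
    then have "(\<Sum>i\<in>UNIV. 2 * (u $ i \<bullet> b)) = 0"
      by (intro DERIV_local_min[OF d zero_less_one]) auto
    then show ?thesis by (simp flip: sum_distrib_left)
  qed
  have "(\<Sum>i\<in>UNIV. u $ i \<bullet> v) = 0" for v
  proof -
    obtain b where b: "norm b = 1" "v = norm v *\<^sub>R b" by (rule unit_direction)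
    have "(\<Sum>i\<in>UNIV. u $ i \<bullet> (t *\<^sub>R b)) = 0" for t
      using unit[OF b(1)] by (simp flip: sum_distrib_left)
    then show ?thesis using b(2) by metis
  qed
  then show ?thesis by (simp add: orthogonal_comp_vertical_iff)
qed

section \<open>Compactness of the gauge group and representatives at minimal distance\<close>

lemma continuous_on_rotation_angle:
  assumes "continuous_on X g" "\<And>x. x \<in> X \<Longrightarrow> g x \<in> SO3"
  shows "continuous_on X (\<lambda>x. rotation_angle (g x))"
proof -
  have "continuous_on X (\<lambda>x. (trace (g x) - 1) / 2)"
    unfolding trace_def by (intro continuous_intros assms(1)) auto
  then show ?thesis
    unfolding rotation_angle_def using SO3_trace_bounds[OF assms(2)] by (intro continuous_on_arccos) auto
qed

lemma continuous_on_mat_mult [continuous_intros]: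
  fixes f g :: "'a::topological_space \<Rightarrow> real^3^3"
  assumes "continuous_on X f" "continuous_on X g"
  shows "continuous_on X (\<lambda>x. f x ** g x)"
  unfolding matrix_matrix_mult_def by (intro continuous_intros assms)

lemma continuous_on_transpose [continuous_intros]:
  fixes f :: "'a::topological_space \<Rightarrow> real^3^3"
  assumes "continuous_on X f"
  shows "continuous_on X (\<lambda>x. transpose (f x))"
  unfolding transpose_def by (intro continuous_intros assms)

lemma compact_SO3: "compact SO3"
proof -
  have eq: "SO3 = {A. transpose A ** A = mat 1} \<inter> {A. A ** transpose A = mat 1} \<inter> {A::real^3^3. det A = 1}"
    by (auto simp: SO3_def rotation_matrix_def orthogonal_matrix_def)
  have "closed SO3"
    unfolding eq det_3 by (intro closed_Int closed_Collect_eq continuous_intros)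
  moreover have "norm A = sqrt 3" if "A \<in> SO3" for A
  proof -
    have "(norm (A $ i))\<^sup>2 = 1" for i
    proof -
      have "(norm (A $ i))\<^sup>2 = (A ** transpose A) $ i $ i"
        by (simp add: power2_norm_eq_inner inner_vec_def matrix_matrix_mult_def transpose_def)
      then show ?thesis by (simp add: SO3_cancel[OF that] mat_def)
    qed
    then show ?thesis by (simp add: norm_vec_def[of A] L2_set_def)
  qed
  then have "bounded SO3" by (intro boundedI[of _ "sqrt 3"]) simp
  ultimately show ?thesis by (simp add: compact_eq_bounded_closed)
qed

lemma config_dist_nonneg: "0 \<le> config_dist P Q"
  by (simp add: config_dist_def sum_nonneg)

lemma gauge_dist_le: "S \<in> SO3 \<Longrightarrow> gauge_dist P Q \<le> config_dist P (gauge_act Q S)"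
  unfolding gauge_dist_def
  by (intro cINF_lower bdd_belowI2[of _ 0]) (simp_all add: config_dist_nonneg)

lemma gauge_dist_attained:
  fixes P Q :: "('n::finite) config"
  assumes P: "P \<in> SO3n" and Q: "Q \<in> SO3n"
  obtains S where "S \<in> SO3" "config_dist P (gauge_act Q S) = gauge_dist P Q"
proof -
  have PQ: "P $ i \<in> SO3" "Q $ i \<in> SO3" for i using P Q by (simp_all add: SO3n_def)
  have "continuous_on SO3 (\<lambda>S. config_dist P (gauge_act Q S))"
    unfolding config_dist_def rot_dist_def gauge_act_def vec_lambda_beta
    by (intro continuous_intros continuous_on_rotation_angle SO3_mult SO3_transpose PQ)
  then obtain S where S: "S \<in> SO3" "\<And>T. T \<in> SO3 \<Longrightarrow> config_dist P (gauge_act Q S) \<le> config_dist P (gauge_act Q T)"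
    using continuous_attains_inf[OF compact_SO3, of "\<lambda>S. config_dist P (gauge_act Q S)"] SO3_one by blast
  have "config_dist P (gauge_act Q S) \<le> gauge_dist P Q"
    unfolding gauge_dist_def using S SO3_one by (intro cINF_greatest) auto
  with gauge_dist_le[OF S(1), of P Q] S(1) that show ?thesis by force
qed

lemma gauge_quotientE:
  assumes "X \<in> gauge_quotient"
  obtains P where "P \<in> SO3n" "X = gauge_class P"
  using assms unfolding gauge_quotient_def by (rule quotientE)

lemma gauge_class_act:
  assumes "P \<in> SO3n" "S \<in> SO3"
  shows "gauge_class (gauge_act P S) = gauge_class P"
proof -
  have "(P, gauge_act P S) \<in> gauge_rel" using assms by (auto simp: gauge_rel_def)
  from equiv_class_eq[OF equiv_gauge_rel this] show ?thesis by simp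
qed

lemma quot_representative:
  fixes P :: "('n::finite) config"
  assumes P: "P \<in> SO3n" and X: "X \<in> gauge_quotient"
  obtains Q where "Q \<in> SO3n" "X = gauge_class Q" "config_dist P Q = quot_dist (gauge_class P) X"
proof -
  obtain Q where Q: "Q \<in> SO3n" "X = gauge_class Q" using gauge_quotientE[OF X] .
  obtain S where S: "S \<in> SO3" "config_dist P (gauge_act Q S) = gauge_dist P Q"
    using gauge_dist_attained[OF P Q(1)] .
  show ?thesis
    by (rule that[of "gauge_act Q S"])
      (simp_all add: gauge_act_SO3n Q S gauge_class_act quot_dist_class P)
qed

lemma quot_dist_le:
  assumes "P \<in> SO3n" "Q \<in> SO3n"
  shows "quot_dist (gauge_class P) (gauge_class Q) \<le> config_dist P Q"
  using gauge_dist_le[OF SO3_one, of P Q] by (simp add: quot_dist_class assms gauge_act_one)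

text \<open>The base \<open>M0\<close> represents the class at a time m < t0, and one nearest
  representative \<open>P\<close> at a time s1 < m is fixed. Alignment with \<open>P\<close> then
  gives all classes at later times nearest representatives on one and the same curve, and (m, t0 +
  e) is a neighbourhood of \<open>t0\<close>. Finally the curve is based anew at
  \<open>t0\<close>.\<close>

lemma quot_geodesic_lift:
  fixes \<gamma> :: "real \<Rightarrow> ('n::finite) config set"
  assumes geo: "quot_geodesic \<gamma> a b" and t0: "a < t0" "t0 < b"
  obtains M w where "M \<in> SO3n" "w \<in> orthogonal_comp vertical_space"
    "\<forall>\<^sub>F s in nhds t0. \<gamma> s = gauge_class (config_exp M ((s - t0) *\<^sub>R w))"
proof -
  have G: "\<gamma> t \<in> gauge_quotient" if "t \<in> {a..b}" for t
    using geo that by (simp add: quot_geodesic_def)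
  obtain c e0 where c: "0 \<le> c" and e0: "0 < e0"
    and d: "\<And>s s'. s \<in> {a..b} \<inter> ball t0 e0 \<Longrightarrow> s' \<in> {a..b} \<inter> ball t0 e0 \<Longrightarrow>
        quot_dist (\<gamma> s) (\<gamma> s') = c * \<bar>s - s'\<bar>"
    using geo t0 unfolding quot_geodesic_def by (metis atLeastAtMost_iff less_imp_le)
  \<comment> \<open>Stays inside the interval and the window of local minimality; the last bound
    keeps the length of any piece of duration below 2e under pi. The summand 1 avoids dividing by
    zero for constant geodesics.\<close>
  define e where "e = Min {e0, t0 - a, b - t0, pi / (2 * (c + 1))}"
  have e: "0 < e" "e \<le> e0" "e \<le> t0 - a" "e \<le> b - t0" "e \<le> pi / (2 * (c + 1))"
    using e0 t0 c unfolding e_def by (auto simp: Min_le_iff)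
  have I: "s \<in> {a..b} \<inter> ball t0 e0" if "\<bar>s - t0\<bar> < e" for s
    using that e by (auto simp: dist_real_def)
  define s1 m where "s1 = t0 - 2 * e / 3" and "m = t0 - e / 3"
  have sm: "\<bar>s1 - t0\<bar> < e" "\<bar>m - t0\<bar> < e" "s1 < m" "m < t0"
    using e(1) by (simp_all add: s1_def m_def)
  obtain M0 where M0: "M0 \<in> SO3n" "\<gamma> m = gauge_class M0"
    using gauge_quotientE[OF G] I[OF sm(2)] by blast
  obtain P where P: "P \<in> SO3n" "\<gamma> s1 = gauge_class P" "config_dist M0 P = quot_dist (\<gamma> m) (\<gamma> s1)"
    using quot_representative[OF M0(1) G] I[OF sm(1)] M0(2) by (metis IntD1)
  obtain x where x: "P = config_exp M0 x" "config_dist M0 P = norm x"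
    using config_eq_exp[OF M0(1) P(1)] by blast
  define u where "u = - x"
  have u: "P = config_exp M0 (- u)" "norm u = c * (m - s1)"
    using x P(3) d[OF I[OF sm(2)] I[OF sm(1)]] sm(3) by (simp_all add: u_def)
  have lt: "c * r < pi" if "r < 2 * e" "0 \<le> r" for r
  proof -
    have "c * r \<le> c * (2 * e)" using that c by (intro mult_left_mono) auto
    also have "\<dots> < (c + 1) * (2 * e)" using e(1) by simp
    also have "\<dots> \<le> (c + 1) * (2 * (pi / (2 * (c + 1))))"
      using e(5) c by (intro mult_left_mono) auto
    also have "\<dots> = pi" using c by (simp add: field_simps)
    finally show ?thesis .
  qed
  define w where "w = u /\<^sub>R (m - s1)"
  have lift: "\<gamma> s = gauge_class (config_exp M0 ((s - m) *\<^sub>R w))" if s: "m < s" "s < t0 + e" for s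
  proof -
    have s': "\<bar>s - t0\<bar> < e" using s sm e(1) by linarith
    obtain Q where Q: "Q \<in> SO3n" "\<gamma> s = gauge_class Q" "config_dist M0 Q = quot_dist (\<gamma> m) (\<gamma> s)"
      using quot_representative[OF M0(1) G] I[OF s'] M0(2) by (metis IntD1)
    obtain v where v: "Q = config_exp M0 v" "config_dist M0 Q = norm v"
      using config_eq_exp[OF M0(1) Q(1)] by blast
    have nv: "norm v = c * (s - m)" using v Q(3) d[OF I[OF sm(2)] I[OF s']] s by simp
    have sum: "norm u + norm v = c * (s - s1)" by (simp add: u nv algebra_simps)
    \<comment> \<open>\<open>P\<close> and \<open>Q\<close> were chosen nearest to
      \<open>M0\<close>, not to each other. Still their distance is at least that of their classes,
      which already equals the length of the path through \<open>M0\<close>.\<close>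
    have "c * (s - s1) = quot_dist (\<gamma> s1) (\<gamma> s)"
      using d[OF I[OF sm(1)] I[OF s']] s sm by simp
    also have "\<dots> \<le> config_dist P Q" unfolding P(2) Q(2) by (intro quot_dist_le P Q)
    finally have "norm u + norm v \<le> config_dist (config_exp M0 (- u)) (config_exp M0 v)"
      by (simp only: sum u(1)[symmetric] v(1)[symmetric])
    moreover have "norm u + norm v < pi"
      unfolding sum using s sm(3) by (intro lt) (auto simp: s1_def)
    ultimately have "norm u *\<^sub>R v = norm v *\<^sub>R u"
      using config_geodesic_unique[OF M0(1)] by blast
    have "v = (s - m) *\<^sub>R w"
    proof (cases "c = 0")
      case True
      then have "u = 0" "v = 0" using u nv by simp_all
      then show ?thesis by (simp add: w_def)
    next
      case False
      have "c *\<^sub>R ((m - s1) *\<^sub>R v) = c *\<^sub>R ((s - m) *\<^sub>R u)"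
        using \<open>norm u *\<^sub>R v = norm v *\<^sub>R u\<close> by (simp add: u nv)
      then have "(m - s1) *\<^sub>R v = (s - m) *\<^sub>R u" using False by (simp del: scaleR_scaleR)
      then have "v = (inverse (m - s1) * (s - m)) *\<^sub>R u"
        using sm(3) by (metis (no_types) scaleR_scaleR scaleR_one left_inverse less_irrefl right_minus_eq)
      then show ?thesis by (simp add: w_def mult.commute)
    qed
    then show ?thesis by (simp add: Q v)
  qed
  have "u \<in> orthogonal_comp vertical_space"
  proof (rule minimizing_imp_horizontal[OF M0(1)])
    have "norm u < pi" unfolding u using sm by (intro lt) (auto simp: s1_def m_def e)
    then show "norm (u $ i) < pi" for i using Finite_Cartesian_Product.norm_nth_le[of u i] by linarith
    fix S :: "real^3^3" assume S: "S \<in> SO3"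
    have "config_dist (config_exp M0 (- u)) M0 = norm u"
      using config_dist_exp_exp[OF M0(1), of u 0] \<open>\<And>i. norm (u $ i) < pi\<close>
      by (simp add: config_exp_zero rot_zero rotation_angle_exp_skew less_imp_le) (simp add: norm_vec_def)
    also have "\<dots> = quot_dist (\<gamma> s1) (\<gamma> m)"
      using d[OF I[OF sm(1)] I[OF sm(2)]] sm(3) by (simp add: u)
    also have "\<dots> = quot_dist (gauge_class P) (gauge_class (gauge_act M0 S))"
      by (simp add: P M0 gauge_class_act S)
    also have "\<dots> \<le> config_dist P (gauge_act M0 S)"
      by (intro quot_dist_le P gauge_act_SO3n M0 S)
    finally show "config_dist (config_exp M0 (- u)) M0 \<le> config_dist (config_exp M0 (- u)) (gauge_act M0 S)"
      by (simp add: u)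
  qed
  then have w: "w \<in> orthogonal_comp vertical_space"
    unfolding w_def by (intro subspace_scale subspace_orthogonal_comp)
  define M where "M = config_exp M0 ((t0 - m) *\<^sub>R w)"
  have "\<forall>\<^sub>F s in nhds t0. s \<in> {m<..<t0 + e}"
    using sm e by (intro eventually_nhds_in_open) auto
  then have "\<forall>\<^sub>F s in nhds t0. \<gamma> s = gauge_class (config_exp M ((s - t0) *\<^sub>R w))"
    by eventually_elim (simp add: lift M_def config_exp_add)
  then show ?thesis using that[of M w] w M0 by (simp add: M_def config_exp_SO3n)
qed

text \<open>For rotations at angle \<theta> the squared Frobenius distance is 6 - 2 tr(A^T B) = 8
  sin(\<theta>/2)^2 \<le> 2 \<theta>^2. This links the matrix topology, in which the cost is
  continuous, to the distance controlled by geodesics.\<close>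

lemma norm_diff_le_config_dist:
  assumes P: "P \<in> SO3n" and Q: "Q \<in> SO3n"
  shows "norm (P - Q) \<le> sqrt 2 * config_dist P Q"
proof -
  have "(norm (P $ i - Q $ i))\<^sup>2 \<le> 2 * (rot_dist (P $ i) (Q $ i))\<^sup>2" for i
  proof -
    have AB: "P $ i \<in> SO3" "Q $ i \<in> SO3" using P Q by (simp_all add: SO3n_def)
    have tr: "A \<bullet> B = trace (transpose A ** B)" for A B :: "real^3^3"
      by (simp add: inner_vec_def trace_def matrix_matrix_mult_def transpose_def sum_3)
    obtain x where x: "norm x = rotation_angle (transpose (P $ i) ** Q $ i)" "transpose (P $ i) ** Q $ i = rot x"
      using SO3_eq_rot_angle[OF SO3_mult[OF SO3_transpose[OF AB(1)] AB(2)]] by blast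
    have "(norm (P $ i - Q $ i))\<^sup>2 = P $ i \<bullet> P $ i + Q $ i \<bullet> Q $ i - 2 * (P $ i \<bullet> Q $ i)"
      by (simp add: power2_norm_eq_inner inner_diff_left inner_diff_right inner_commute)
    also have "\<dots> = 4 * (1 - cos (norm x))"
      unfolding tr x(2) trace_exp_skew by (simp add: SO3_cancel AB trace_I)
    also have "\<dots> = 8 * (sin (norm x / 2))\<^sup>2"
      using cos_double_sin[of "norm x / 2"] by simp
    also have "\<dots> \<le> 8 * (norm x / 2)\<^sup>2"
      using abs_sin_x_le_abs_x[of "norm x / 2"]
      by (intro mult_left_mono) (simp_all only: abs_le_square_iff zero_le_numeral)
    finally show ?thesis by (simp add: x rot_dist_def power_divide)
  qed
  then have "(\<Sum>i\<in>UNIV. (norm (P $ i - Q $ i))\<^sup>2) \<le> (\<Sum>i\<in>UNIV. 2 * (rot_dist (P $ i) (Q $ i))\<^sup>2)"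
    by (rule sum_mono)
  then show ?thesis
    by (simp add: norm_vec_def L2_set_def config_dist_def real_sqrt_mult[symmetric] sum_distrib_left)
qed

lemma continuous_on_averaging_cost:
  fixes E :: "(('n::finite) \<times> 'n) set"
  assumes "p > 1" and Rt: "\<And>i j. (i, j) \<in> E \<Longrightarrow> Rt i j \<in> SO3"
  shows "continuous_on SO3n (averaging_cost p E Rt)"
proof -
  have "continuous_on SO3n (\<lambda>R. rot_dist (Rt i j) (R $ i ** transpose (R $ j)) powr p)" if "(i, j) \<in> E" for i j
  proof (rule continuous_on_powr')
    have mem: "transpose (Rt i j) ** (R $ i ** transpose (R $ j)) \<in> SO3" if "R \<in> SO3n" for R :: "'n config"
      using that Rt \<open>(i, j) \<in> E\<close> by (intro SO3_mult SO3_transpose) (auto simp: SO3n_def)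
    then show "continuous_on SO3n (\<lambda>R :: 'n config. rot_dist (Rt i j) (R $ i ** transpose (R $ j)))"
      unfolding rot_dist_def by (intro continuous_on_rotation_angle continuous_intros) auto
    show "\<forall>R\<in>SO3n. 0 \<le> rot_dist (Rt i j) (R $ i ** transpose (R $ j)) \<and>
        (rot_dist (Rt i j) (R $ i ** transpose (R $ j)) = 0 \<longrightarrow> 0 < p)"
      using mem assms(1) by (auto simp: rot_dist_def rotation_angle_nonneg)
  qed (intro continuous_intros)
  then show ?thesis unfolding averaging_cost_def by (intro continuous_on_sum) auto
qed

text \<open>Needed at the endpoints, where no lift is available. A geodesic is locally Lipschitz for
  the quotient distance, and each nearby class has a representative that close to
  \<open>P\<close>.\<close>

lemma continuous_on_cost_geodesic:
  fixes \<gamma> :: "real \<Rightarrow> ('n::finite) config set"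
  assumes geo: "quot_geodesic \<gamma> a b" and p: "p > 1" and Rt: "\<And>i j. (i, j) \<in> E \<Longrightarrow> Rt i j \<in> SO3"
  shows "continuous_on {a..b} (\<lambda>t. quot_fun (averaging_cost p E Rt) (\<gamma> t))"
  unfolding continuous_on_iff
proof (intro ballI allI impI)
  fix t \<epsilon> :: real assume t: "t \<in> {a..b}" and \<epsilon>: "0 < \<epsilon>"
  let ?f = "averaging_cost p E Rt"
  have G: "\<gamma> t \<in> gauge_quotient" if "t \<in> {a..b}" for t
    using geo that by (simp add: quot_geodesic_def)
  obtain P where P: "P \<in> SO3n" "\<gamma> t = gauge_class P" using gauge_quotientE[OF G[OF t]] .
  obtain c e where c: "0 \<le> c" and e: "0 < e"
    and d: "\<And>s s'. s \<in> {a..b} \<inter> ball t e \<Longrightarrow> s' \<in> {a..b} \<inter> ball t e \<Longrightarrow>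
        quot_dist (\<gamma> s) (\<gamma> s') = c * \<bar>s - s'\<bar>"
    using geo t unfolding quot_geodesic_def by metis
  have cont: "continuous_on SO3n ?f"
    by (rule continuous_on_averaging_cost[OF p Rt])
  obtain \<delta> where \<delta>: "0 < \<delta>" "\<And>Q. Q \<in> SO3n \<Longrightarrow> dist Q P < \<delta> \<Longrightarrow> dist (?f Q) (?f P) < \<epsilon>"
    using cont[unfolded continuous_on_iff, rule_format, OF P(1) \<epsilon>] by blast
  define \<eta> where "\<eta> = min e (\<delta> / (sqrt 2 * (c + 1)))"
  have \<eta>: "0 < \<eta>" "\<eta> \<le> e" "\<eta> \<le> \<delta> / (sqrt 2 * (c + 1))"
    using e \<delta> c by (simp_all add: \<eta>_def)
  have "dist (quot_fun ?f (\<gamma> s)) (quot_fun ?f (\<gamma> t)) < \<epsilon>" if s: "s \<in> {a..b}" "dist s t < \<eta>" for s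
  proof -
    obtain Q where Q: "Q \<in> SO3n" "\<gamma> s = gauge_class Q" "config_dist P Q = quot_dist (\<gamma> t) (\<gamma> s)"
      using quot_representative[OF P(1) G[OF s(1)]] P(2) by metis
    have "config_dist P Q = c * \<bar>t - s\<bar>"
      unfolding Q(3) using d[of t s] t s \<eta> e by (simp add: dist_commute)
    then have "norm (P - Q) \<le> sqrt 2 * (c * \<bar>t - s\<bar>)"
      using norm_diff_le_config_dist[OF P(1) Q(1)] by simp
    also have "\<dots> \<le> (sqrt 2 * (c + 1)) * \<bar>t - s\<bar>"
      by (simp add: distrib_left distrib_right)
    also have "\<dots> < (sqrt 2 * (c + 1)) * (\<delta> / (sqrt 2 * (c + 1)))"
      using s(2) \<eta>(3) c by (intro mult_strict_left_mono) (auto simp: dist_real_def abs_minus_commute add_nonneg_pos)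
    also have "\<dots> = \<delta>" using c by simp
    finally have "dist (?f Q) (?f P) < \<epsilon>"
      by (intro \<delta>(2) Q(1)) (simp add: dist_norm norm_minus_commute)
    then show ?thesis by (simp add: P Q quot_fun_averaging_cost)
  qed
  then show "\<exists>d>0. \<forall>s\<in>{a..b}. dist s t < d \<longrightarrow> dist (quot_fun ?f (\<gamma> s)) (quot_fun ?f (\<gamma> t)) < \<epsilon>"
    using \<eta>(1) by blast
qed

section \<open>Second derivatives along curves\<close>

text \<open>The values of both derivatives are parameters, so they can be computed rule by rule. As
  in \<open>has_second_derivative\<close>, the first derivative exists near \<open>t\<close> and the
  second only at \<open>t\<close>.\<close>

definition jet2 :: "(real \<Rightarrow> 'a::real_normed_vector) \<Rightarrow> 'a \<Rightarrow> 'a \<Rightarrow> real \<Rightarrow> bool" where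
  "jet2 x x1 x2 t \<longleftrightarrow> (\<exists>x'. (\<forall>\<^sub>F s in nhds t. (x has_vector_derivative x' s) (at s)) \<and>
     x' t = x1 \<and> (x' has_vector_derivative x2) (at t))"

lemma jet2I:
  assumes "\<forall>\<^sub>F s in nhds t. (x has_vector_derivative x' s) (at s)" "x' t = x1"
    "(x' has_vector_derivative x2) (at t)"
  shows "jet2 x x1 x2 t"
  using assms unfolding jet2_def by blast

lemma jet2E:
  assumes "jet2 x x1 x2 t"
  obtains x' where "\<forall>\<^sub>F s in nhds t. (x has_vector_derivative x' s) (at s)" "x' t = x1"
    "(x' has_vector_derivative x2) (at t)" "(x has_vector_derivative x1) (at t)" "isCont x t"
proof -
  obtain x' where x': "\<forall>\<^sub>F s in nhds t. (x has_vector_derivative x' s) (at s)" "x' t = x1"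
    "(x' has_vector_derivative x2) (at t)"
    using assms unfolding jet2_def by blast
  then have "(x has_vector_derivative x1) (at t)" using eventually_nhds_x_imp_x by force
  with x' that show ?thesis using has_vector_derivative_continuous by blast
qed

lemma jet2_const: "jet2 (\<lambda>_. c) 0 0 t"
  by (rule jet2I[where x' = "\<lambda>_. 0"]) (auto intro!: always_eventually)

lemma jet2_add:
  assumes "jet2 x x1 x2 t" "jet2 y y1 y2 t"
  shows "jet2 (\<lambda>s. x s + y s) (x1 + y1) (x2 + y2) t"
proof -
  obtain x' where x': "\<forall>\<^sub>F s in nhds t. (x has_vector_derivative x' s) (at s)" "x' t = x1"
    "(x' has_vector_derivative x2) (at t)" using jet2E[OF assms(1)] by blast
  obtain y' where y': "\<forall>\<^sub>F s in nhds t. (y has_vector_derivative y' s) (at s)" "y' t = y1"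
    "(y' has_vector_derivative y2) (at t)" using jet2E[OF assms(2)] by blast
  show ?thesis
  proof (rule jet2I[where x' = "\<lambda>s. x' s + y' s"])
    show "\<forall>\<^sub>F s in nhds t. ((\<lambda>s. x s + y s) has_vector_derivative x' s + y' s) (at s)"
      using x'(1) y'(1) by eventually_elim (rule has_vector_derivative_add)
  qed (use x' y' in \<open>auto intro: has_vector_derivative_add\<close>)
qed

lemma jet2_linear:
  assumes "bounded_linear L" "jet2 x x1 x2 t"
  shows "jet2 (\<lambda>s. L (x s)) (L x1) (L x2) t"
proof -
  obtain x' where x': "\<forall>\<^sub>F s in nhds t. (x has_vector_derivative x' s) (at s)" "x' t = x1"
    "(x' has_vector_derivative x2) (at t)" using jet2E[OF assms(2)] by blast
  show ?thesis
  proof (rule jet2I[where x' = "\<lambda>s. L (x' s)"])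
    show "\<forall>\<^sub>F s in nhds t. ((\<lambda>s. L (x s)) has_vector_derivative L (x' s)) (at s)"
      using x'(1) by eventually_elim (rule bounded_linear.has_vector_derivative[OF assms(1)])
  qed (use x' in \<open>auto intro: bounded_linear.has_vector_derivative[OF assms(1)]\<close>)
qed

lemma (in bounded_bilinear) jet2:
  assumes "jet2 x x1 x2 t" "jet2 y y1 y2 t"
  shows "jet2 (\<lambda>s. prod (x s) (y s)) (prod x1 (y t) + prod (x t) y1)
     (prod x2 (y t) + 2 *\<^sub>R prod x1 y1 + prod (x t) y2) t"
proof -
  obtain x' where x': "\<forall>\<^sub>F s in nhds t. (x has_vector_derivative x' s) (at s)" "x' t = x1"
    "(x' has_vector_derivative x2) (at t)" "(x has_vector_derivative x1) (at t)" using jet2E[OF assms(1)] by blast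
  obtain y' where y': "\<forall>\<^sub>F s in nhds t. (y has_vector_derivative y' s) (at s)" "y' t = y1"
    "(y' has_vector_derivative y2) (at t)" "(y has_vector_derivative y1) (at t)" using jet2E[OF assms(2)] by blast
  show ?thesis
  proof (rule jet2I[where x' = "\<lambda>s. prod (x s) (y' s) + prod (x' s) (y s)"])
    show "\<forall>\<^sub>F s in nhds t. ((\<lambda>s. prod (x s) (y s)) has_vector_derivative prod (x s) (y' s) + prod (x' s) (y s)) (at s)"
      using x'(1) y'(1) by eventually_elim (rule has_vector_derivative)
    have "((\<lambda>s. prod (x s) (y' s) + prod (x' s) (y s)) has_vector_derivative
        (prod (x t) y2 + prod x1 (y' t)) + (prod (x' t) y1 + prod x2 (y t))) (at t)"
      by (intro has_vector_derivative_add has_vector_derivative x' y')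
    then show "((\<lambda>s. prod (x s) (y' s) + prod (x' s) (y s)) has_vector_derivative
        (prod x2 (y t) + 2 *\<^sub>R prod x1 y1 + prod (x t) y2)) (at t)"
      by (simp add: x' y' scaleR_2 add_ac)
  qed (simp add: x' y' add.commute)
qed

lemma jet2_compose_real:
  fixes r :: "real \<Rightarrow> real"
  assumes "jet2 f f1 f2 (r t)" "jet2 r r1 r2 t"
  shows "jet2 (\<lambda>s. f (r s)) (r1 *\<^sub>R f1) (r2 *\<^sub>R f1 + (r1 * r1) *\<^sub>R f2) t"
proof -
  obtain f' where f': "\<forall>\<^sub>F s in nhds (r t). (f has_vector_derivative f' s) (at s)" "f' (r t) = f1"
    "(f' has_vector_derivative f2) (at (r t))" using jet2E[OF assms(1)] by blast
  obtain r' where r': "\<forall>\<^sub>F s in nhds t. (r has_vector_derivative r' s) (at s)" "r' t = r1"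
    "(r' has_vector_derivative r2) (at t)" "(r has_vector_derivative r1) (at t)" "isCont r t"
    using jet2E[OF assms(2)] by blast
  have "filterlim r (nhds (r t)) (nhds t)"
    using r'(5) by (simp add: isCont_def tendsto_at_iff_tendsto_nhds)
  then have ev: "\<forall>\<^sub>F s in nhds t. (f has_vector_derivative f' (r s)) (at (r s))"
    using f'(1) by (rule eventually_compose_filterlim[rotated])
  show ?thesis
  proof (rule jet2I[where x' = "\<lambda>s. r' s *\<^sub>R f' (r s)"])
    show "\<forall>\<^sub>F s in nhds t. ((\<lambda>s. f (r s)) has_vector_derivative r' s *\<^sub>R f' (r s)) (at s)"
      using ev r'(1) by eventually_elim (rule vector_diff_chain_at[unfolded o_def])
    have "((\<lambda>s. f' (r s)) has_vector_derivative r1 *\<^sub>R f2) (at t)"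
      using vector_diff_chain_at[OF r'(4) f'(3)] by (simp add: o_def)
    from bounded_bilinear.has_vector_derivative[OF bounded_bilinear_scaleR r'(3) this]
    show "((\<lambda>s. r' s *\<^sub>R f' (r s)) has_vector_derivative r2 *\<^sub>R f1 + (r1 * r1) *\<^sub>R f2) (at t)"
      by (simp add: r' f' add.commute)
  qed (simp add: r' f')
qed

lemma jet2_vec:
  fixes x :: "real \<Rightarrow> 'a::euclidean_space ^ 'n::finite"
  assumes "\<And>i. jet2 (\<lambda>s. x s $ i) (x1 $ i) (x2 $ i) t"
  shows "jet2 x x1 x2 t"
proof -
  \<comment> \<open>Coordinate embeddings: a vector is the finite sum of its embedded components,
    which reduces the claim to sums and linear images.\<close>
  define J :: "'n \<Rightarrow> 'a \<Rightarrow> 'a ^ 'n" where "J i v = (\<chi> j. if j = i then v else 0)" for i v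
  have J: "bounded_linear (J i)" for i
    unfolding linear_conv_bounded_linear[symmetric] J_def by (rule linearI) (auto simp: vec_eq_iff)
  have e: "(\<Sum>i\<in>UNIV. J i (y $ i)) = y" for y
    by (simp add: J_def vec_eq_iff)
  have "jet2 (\<lambda>s. \<Sum>i\<in>A. J i (x s $ i)) (\<Sum>i\<in>A. J i (x1 $ i)) (\<Sum>i\<in>A. J i (x2 $ i)) t" if "finite A" for A
    using that
  proof induction
    case (insert i A)
    have "jet2 (\<lambda>s. J i (x s $ i)) (J i (x1 $ i)) (J i (x2 $ i)) t"
      by (rule jet2_linear[OF J assms])
    from jet2_add[OF this insert.IH] insert.hyps show ?case by simp
  qed (simp add: jet2_const)
  from this[of UNIV] show ?thesis by (simp add: e)
qed

text \<open>Geodesics through points other than \<open>R\<close> are not straight in the chart at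
  \<open>R\<close>; their acceleration enters through the term with \<open>f'\<close>.\<close>

lemma jet2_C2:
  fixes f' :: "'a::real_normed_vector \<Rightarrow> 'a \<Rightarrow>\<^sub>L real" and f'' :: "'a \<Rightarrow> 'a \<Rightarrow>\<^sub>L 'a \<Rightarrow>\<^sub>L real"
  assumes U: "open U" "x t \<in> U"
    and f: "\<And>y. y \<in> U \<Longrightarrow> (f has_derivative blinfun_apply (f' y)) (at y)"
    and f': "(f' has_derivative blinfun_apply (f'' (x t))) (at (x t))"
    and x: "jet2 x x1 x2 t"
  shows "jet2 (\<lambda>s. f (x s)) (f' (x t) x1) (f'' (x t) x1 x1 + f' (x t) x2) t"
proof -
  obtain x' where x': "\<forall>\<^sub>F s in nhds t. (x has_vector_derivative x' s) (at s)" "x' t = x1"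
    "(x' has_vector_derivative x2) (at t)" "(x has_vector_derivative x1) (at t)" "isCont x t"
    using jet2E[OF x] by blast
  have chain: "((\<lambda>s. g (x s)) has_vector_derivative g' v) (at s)"
    if "(g has_derivative g') (at (x s))" "(x has_vector_derivative v) (at s)" for g :: "'a \<Rightarrow> 'c::real_normed_vector" and g' v s
  proof -
    have "bounded_linear g'" using that(1) by (rule has_derivative_bounded_linear)
    then have "(\<lambda>h. g' (h *\<^sub>R v)) = (\<lambda>h. h *\<^sub>R g' v)" by (simp add: linear_simps)
    then show ?thesis
      using has_derivative_compose[OF that(2)[unfolded has_vector_derivative_def] that(1)]
      by (simp add: has_vector_derivative_def)
  qed
  have "\<forall>\<^sub>F s in nhds t. x s \<in> U"
    using x'(5) U by (intro topological_tendstoD) (auto simp: isCont_def tendsto_at_iff_tendsto_nhds)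
  show ?thesis
  proof (rule jet2I[where x' = "\<lambda>s. f' (x s) (x' s)"])
    show "\<forall>\<^sub>F s in nhds t. ((\<lambda>s. f (x s)) has_vector_derivative f' (x s) (x' s)) (at s)"
      using x'(1) \<open>\<forall>\<^sub>F s in nhds t. x s \<in> U\<close> by eventually_elim (rule chain[OF f])
    have "((\<lambda>s. f' (x s)) has_vector_derivative f'' (x t) x1) (at t)"
      by (rule chain[OF f' x'(4)])
    from bounded_bilinear.has_vector_derivative[OF bounded_bilinear_blinfun_apply this x'(3)]
    show "((\<lambda>s. f' (x s) (x' s)) has_vector_derivative f'' (x t) x1 x1 + f' (x t) x2) (at t)"
      by (simp add: x' add.commute)
  qed (simp add: x')
qed

lemma jet2_cong:
  assumes ev: "\<forall>\<^sub>F s in nhds t. x s = y s" and y: "jet2 y y1 y2 t"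
  shows "jet2 x y1 y2 t"
proof -
  obtain y' where y': "\<forall>\<^sub>F s in nhds t. (y has_vector_derivative y' s) (at s)" "y' t = y1"
    "(y' has_vector_derivative y2) (at t)" using jet2E[OF y] by blast
  have "\<forall>\<^sub>F s in nhds t. \<forall>\<^sub>F r in nhds s. x r = y r" using ev by (simp add: eventually_eventually)
  with y'(1) have "\<forall>\<^sub>F s in nhds t. (x has_vector_derivative y' s) (at s)"
  proof eventually_elim
    case (elim s)
    show ?case
      using elim(1) eventually_nhds_x_imp_x[OF elim(2)] elim(2)
      by (subst has_vector_derivative_cong_ev[where g = y]) auto
  qed
  with y' show ?thesis unfolding jet2_def by blast
qed

section \<open>From nonnegative second derivatives to convexity\<close>

lemma jet2_imp_has_second_derivative: "jet2 g g1 q t \<Longrightarrow> has_second_derivative g q t"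
  unfolding jet2_def has_second_derivative_def has_real_derivative_iff_has_vector_derivative by blast

lemma has_second_derivative_unique:
  assumes "has_second_derivative g q t" "has_second_derivative g q' t"
  shows "q = q'"
proof -
  obtain g1 where g1: "\<forall>\<^sub>F s in nhds t. (g has_real_derivative g1 s) (at s)" "(g1 has_real_derivative q) (at t)"
    using assms(1) unfolding has_second_derivative_def by blast
  obtain g2 where g2: "\<forall>\<^sub>F s in nhds t. (g has_real_derivative g2 s) (at s)" "(g2 has_real_derivative q') (at t)"
    using assms(2) unfolding has_second_derivative_def by blast
  have "\<forall>\<^sub>F s in nhds t. g1 s = g2 s"
    using g1(1) g2(1) by eventually_elim (rule DERIV_unique)
  then have "(g1 has_real_derivative q') (at t)"
    using g2(2) by (subst DERIV_cong_ev[OF refl _ refl])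
  with g1(2) show ?thesis by (rule DERIV_unique)
qed

lemma convex_on_Icc_second_derivative:
  assumes cont: "continuous_on {a..b} f"
    and d2: "\<And>t. a < t \<Longrightarrow> t < b \<Longrightarrow> \<exists>q\<ge>0. has_second_derivative f q t"
  shows "convex_on {a..b} f"
proof -
  obtain q where q: "0 \<le> q t" "has_second_derivative f (q t) t" if "t \<in> {a<..<b}" for t
    using d2 by (metis greaterThanLessThan_iff)
  \<comment> \<open>Each time brings its own first derivative, valid only nearby; all of them agree
    with \<open>deriv f\<close>, which serves on the whole open interval.\<close>
  have D: "(f has_real_derivative deriv f t) (at t)" "(deriv f has_real_derivative q t) (at t)"
    if t: "t \<in> {a<..<b}" for t
  proof -
    obtain g where g: "\<forall>\<^sub>F s in nhds t. (f has_real_derivative g s) (at s)" "(g has_real_derivative q t) (at t)"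
      using q(2)[OF t] unfolding has_second_derivative_def by blast
    then have ev: "\<forall>\<^sub>F s in nhds t. deriv f s = g s"
      by (auto elim: eventually_mono intro: DERIV_imp_deriv)
    show "(f has_real_derivative deriv f t) (at t)"
      using eventually_nhds_x_imp_x[OF g(1)] eventually_nhds_x_imp_x[OF ev] by simp
    show "(deriv f has_real_derivative q t) (at t)"
      using g(2) by (subst DERIV_cong_ev[OF refl ev refl])
  qed
  have conv: "convex_on {a<..<b} f"
    by (rule f''_ge0_imp_convex[of _ _ "deriv f" q]) (use D q in auto)
  show ?thesis
  proof (rule convex_onI)
    fix t x y :: real assume t: "0 < t" "t < 1" and x: "x \<in> {a..b}" and y: "y \<in> {a..b}"
    show "f ((1 - t) *\<^sub>R x + t *\<^sub>R y) \<le> (1 - t) * f x + t * f y"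
    proof (cases "a < b")
      case False
      with x y have "x = y" by auto
      then show ?thesis by (simp add: algebra_simps)
    next
      case True
      \<comment> \<open>Shrinking towards the midpoint is affine, hence respects convex
        combinations, and moves all points into the open interval. Letting \<open>s\<close> tend to
        0 from the right transfers the inequality by continuity.\<close>
      define m where "m = (a + b) / 2"
      define sh where "sh s z = z + s * (m - z)" for s z
      have in1: "sh s z \<in> {a<..<b}" if "z \<in> {a..b}" "0 < s" "s < 1" for s z
      proof -
        have e: "sh s z = (1 - s) * z + s * m" by (simp add: sh_def algebra_simps)
        have "(1 - s) * a \<le> (1 - s) * z" "(1 - s) * z \<le> (1 - s) * b" "s * a < s * m" "s * m < s * b"
          using that True by (auto simp: m_def intro!: mult_left_mono mult_strict_left_mono)
        then have "(1 - s) * a + s * a < sh s z" "sh s z < (1 - s) * b + s * b" unfolding e by linarith+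
        then show ?thesis by (simp add: algebra_simps)
      qed
      have lim: "((\<lambda>s. f (sh s z)) \<longlongrightarrow> f z) (at_right 0)" if z: "z \<in> {a..b}" for z
      proof -
        have "((\<lambda>s. sh s z) \<longlongrightarrow> sh 0 z) (at_right 0)"
          unfolding sh_def by (intro tendsto_intros)
        then have l: "((\<lambda>s. sh s z) \<longlongrightarrow> z) (at_right 0)" by (simp add: sh_def)
        have "\<forall>\<^sub>F s in at_right 0. sh s z \<in> {a..b}"
          using eventually_at_right_real[OF zero_less_one] 
          by eventually_elim (use in1[OF z] in force)
        from continuous_on_tendsto_compose[OF cont l z this] show ?thesis .
      qed
      have m: "(1 - t) *\<^sub>R x + t *\<^sub>R y \<in> {a..b}"
        using convexD[OF convex_real_interval(5) x y, of "1 - t" t] t by simp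
      have "\<forall>\<^sub>F s in at_right 0. f (sh s ((1 - t) *\<^sub>R x + t *\<^sub>R y)) \<le> (1 - t) * f (sh s x) + t * f (sh s y)"
        using eventually_at_right_real[OF zero_less_one]
      proof eventually_elim
        case (elim s)
        have "sh s ((1 - t) *\<^sub>R x + t *\<^sub>R y) = (1 - t) *\<^sub>R sh s x + t *\<^sub>R sh s y"
          by (simp add: sh_def algebra_simps)
        then show ?case using convex_onD[OF conv, of t "sh s x" "sh s y"] in1 x y elim t by simp
      qed
      moreover have "((\<lambda>s. (1 - t) * f (sh s x) + t * f (sh s y)) \<longlongrightarrow> (1 - t) * f x + t * f y) (at_right 0)"
        by (intro tendsto_add tendsto_mult tendsto_const lim x y)
      ultimately show ?thesis
        using tendsto_le[OF _ _ lim[OF m]] trivial_limit_at_right_real by blast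
    qed
  qed simp
qed

section \<open>Rodrigues coordinates\<close>

text \<open>\<open>atn m\<close> is the \<open>m\<close>-th derivative of $\arctan(\sqrt s)/\sqrt s$, which as a power series
  is smooth also at $s = 0$.\<close>
definition atn_coeff :: "nat \<Rightarrow> real" where
  "atn_coeff k = (- 1) ^ k / real (2 * k + 1)"

definition atn :: "nat \<Rightarrow> real \<Rightarrow> real" where
  "atn m s = (\<Sum>k. (diffs ^^ m) atn_coeff k * s ^ k)"

lemma summable_atn: "\<bar>s\<bar> < 1 \<Longrightarrow> summable (\<lambda>k. (diffs ^^ m) atn_coeff k * s ^ k)"
proof (induction m arbitrary: s)
  case 0
  have "summable (\<lambda>k. \<bar>s\<bar> ^ k)" using 0 by (simp add: summable_geometric)
  then show ?case
  proof (rule summable_comparison_test'[where N = 0])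
    fix k
    have "\<bar>atn_coeff k\<bar> \<le> 1" by (simp add: atn_coeff_def power_abs)
    then have "\<bar>atn_coeff k\<bar> * \<bar>s\<bar> ^ k \<le> 1 * \<bar>s\<bar> ^ k" by (intro mult_right_mono) auto
    then show "norm ((diffs ^^ 0) atn_coeff k * s ^ k) \<le> \<bar>s\<bar> ^ k"
      by (simp add: abs_mult power_abs)
  qed
next
  case (Suc m)
  then show ?case using termdiff_converges[of s 1 "(diffs ^^ m) atn_coeff"] by simp
qed

lemma DERIV_atn: "\<bar>s\<bar> < 1 \<Longrightarrow> (atn m has_real_derivative atn (Suc m) s) (at s)"
  using termdiffs_strong'[of 1 "(diffs ^^ m) atn_coeff" s] summable_atn[of _ m]
  by (simp add: atn_def[abs_def])

lemma continuous_on_atn: "continuous_on {-1<..<1} (atn m)"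
  by (intro continuous_at_imp_continuous_on ballI DERIV_isCont[OF DERIV_atn]) auto

lemma arctan_eq_atn:
  assumes "\<bar>r\<bar> < 1"
  shows "arctan r = r * atn 0 (r\<^sup>2)"
proof -
  have "r\<^sup>2 < 1" using assms by (simp add: abs_square_less_1)
  then have "r * atn 0 (r\<^sup>2) = (\<Sum>k. r * (atn_coeff k * (r\<^sup>2) ^ k))"
    using summable_atn[of "r\<^sup>2" 0] unfolding atn_def by (subst suminf_mult) auto
  also have "\<dots> = (\<Sum>k. (-1)^k * (1 / real (k * 2 + 1) * r ^ (k * 2 + 1)))"
    by (simp add: atn_coeff_def power_mult[symmetric] mult_ac)
  also have "\<dots> = arctan r" using assms by (intro arctan_series[symmetric]) simp
  finally show ?thesis ..
qed

lemma jet2_atn: "\<bar>s\<bar> < 1 \<Longrightarrow> jet2 (atn 0) (atn 1 s) (atn 2 s) s"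
proof -
  assume s: "\<bar>s\<bar> < 1"
  have "\<forall>\<^sub>F x in nhds s. x \<in> {-1<..<1}"
    using s by (intro eventually_nhds_in_open) auto
  then have "\<forall>\<^sub>F x in nhds s. (atn 0 has_vector_derivative atn 1 x) (at x)"
    by eventually_elim (use DERIV_atn[of _ 0] in \<open>simp add: has_real_derivative_iff_has_vector_derivative[symmetric] abs_less_iff\<close>)
  then show ?thesis
    using DERIV_atn[OF s, of 1]
    by (intro jet2I[where x' = "atn 1"]) (simp_all add: has_real_derivative_iff_has_vector_derivative numeral_2_eq_2)
qed

text \<open>The Cayley transform: the rotation with Rodrigues vector \<open>z\<close>, of angle $2\arctan\|z\|$.
  In these coordinates products of rotations are rational and geodesics are straight lines.\<close>
definition cay :: "real^3 \<Rightarrow> real^3^3" where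
  "cay z = (1 / (1 + z \<bullet> z)) *\<^sub>R quat_mat 1 z"

text \<open>This is 2 arctan(|z|)/|z| times \<open>z\<close>, the exponential coordinate of
  \<open>cay z\<close> for |z| < 1. Written through the squared norm, it is analytic at 0; the
  restriction is the radius of convergence.\<close>

definition cay_log :: "real^3 \<Rightarrow> real^3" where
  "cay_log z = (2 * atn 0 (z \<bullet> z)) *\<^sub>R z"

lemma quat_mat_eq_cay:
  assumes "w\<^sup>2 + x \<bullet> x = 1" "w \<noteq> 0"
  shows "quat_mat w x = cay (x /\<^sub>R w)"
proof -
  have "1 + (x /\<^sub>R w) \<bullet> (x /\<^sub>R w) = 1 / w\<^sup>2"
    using assms by (simp add: field_simps power2_eq_square)
  moreover have "quat_mat w x = w\<^sup>2 *\<^sub>R quat_mat 1 (x /\<^sub>R w)"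
    using quat_mat_scale[of w 1 "x /\<^sub>R w"] assms(2) by simp
  ultimately show ?thesis by (simp add: cay_def)
qed

lemma rot_cay_log:
  assumes "norm z < 1"
  shows "rot (cay_log z) = cay z"
proof -
  obtain a where a: "norm a = 1" "z = norm z *\<^sub>R a" by (rule unit_direction)
  define \<theta> where "\<theta> = arctan (norm z)"
  have "cay_log z = (2 * \<theta>) *\<^sub>R a"
    using arctan_eq_atn[of "norm z"] assms a(2) unfolding cay_log_def \<theta>_def
    by (metis (no_types, lifting) abs_norm_cancel dot_square_norm mult.assoc mult.commute scaleR_scaleR)
  then have "rot (cay_log z) = quat_mat (cos \<theta>) (sin \<theta> *\<^sub>R a)"
    using mat_exp_skew_unit[OF a(1), of "2 * \<theta>"] by simp
  also have "\<dots> = cay ((sin \<theta> *\<^sub>R a) /\<^sub>R cos \<theta>)"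
    using a(1) by (intro quat_mat_eq_cay) (simp_all add: norm_eq_1 \<theta>_def power2_eq_square[symmetric])
  also have "(sin \<theta> *\<^sub>R a) /\<^sub>R cos \<theta> = tan \<theta> *\<^sub>R a"
    by (simp add: tan_def divide_inverse mult.commute)
  also have "\<dots> = z" using a(2) by (simp add: \<theta>_def tan_arctan)
  finally show ?thesis .
qed

text \<open>At \<open>w = 0\<close> the value is the limit, so that the differential equation in
  \<open>DERIV_half_tan\<close> holds there too.\<close>
definition half_tan :: "real^3 \<Rightarrow> real \<Rightarrow> real" where
  "half_tan w t = (if w = 0 then t / 2 else tan (t * norm w / 2) / norm w)"

lemma rot_eq_cay:
  assumes "\<bar>t\<bar> * norm w < pi"
  shows "rot (t *\<^sub>R w) = cay (half_tan w t *\<^sub>R w)"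
proof (cases "w = 0")
  case True
  then show ?thesis by (simp add: rot_zero cay_def quat_mat_one)
next
  case False
  obtain a where a: "norm a = 1" "w = norm w *\<^sub>R a" by (rule unit_direction)
  define h where "h = t * norm w / 2"
  have "\<bar>h\<bar> < pi / 2" using assms by (simp add: h_def abs_mult)
  then have "0 < cos h" by (intro cos_gt_zero_pi) linarith+
  then have c: "cos h \<noteq> 0" by simp
  have "t *\<^sub>R w = (2 * h) *\<^sub>R a" using a(2) by (metis h_def scaleR_scaleR field_sum_of_halves mult_2)
  then have "rot (t *\<^sub>R w) = quat_mat (cos h) (sin h *\<^sub>R a)"
    using mat_exp_skew_unit[OF a(1), of "2 * h"] by simp
  also have "\<dots> = cay ((sin h *\<^sub>R a) /\<^sub>R cos h)"
    using a(1) c by (intro quat_mat_eq_cay) (simp_all add: norm_eq_1 power2_eq_square[symmetric])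
  also have "(sin h *\<^sub>R a) /\<^sub>R cos h = tan h *\<^sub>R a"
    by (simp add: tan_def divide_inverse mult.commute)
  also have "\<dots> = (tan h / norm w) *\<^sub>R (norm w *\<^sub>R a)" using False by simp
  also have "\<dots> = half_tan w t *\<^sub>R w" using False a(2) by (simp add: half_tan_def h_def)
  finally show ?thesis .
qed

text \<open>Source of the radius 2 arctan d in the final theorem: halving the angle and taking the
  tangent turns it into a bound \<open>d\<close> on the Rodrigues vector.\<close>

lemma norm_half_tan_less:
  assumes "norm y < 2 * arctan d"
  shows "norm (half_tan y 1 *\<^sub>R y) < d"
proof -
  have d: "0 < d" using assms norm_ge_zero[of y] by (metis arctan_less_zero_iff linorder_not_less mult_2 add_nonpos_nonpos arctan_le_zero_iff order_trans)
  show ?thesis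
  proof (cases "y = 0")
    case False
    have "norm y / 2 < arctan d" using assms by simp
    then have "tan (norm y / 2) < tan (arctan d)"
      using False arctan_ubound[of d] by (intro tan_monotone) (auto intro: order_less_trans[of _ 0])
    moreover have "0 < tan (norm y / 2)"
      using False assms arctan_ubound[of d] by (intro tan_gt_zero) auto
    ultimately show ?thesis using False by (simp add: half_tan_def tan_arctan)
  qed (simp add: d)
qed

text \<open>A Riccati equation, which lets later second derivatives be found without differentiating
  the tangent twice.\<close>

lemma DERIV_half_tan:
  assumes "\<bar>t\<bar> * norm w < pi"
  shows "(half_tan w has_real_derivative (1 + (norm w)\<^sup>2 * (half_tan w t)\<^sup>2) / 2) (at t)"
proof (cases "w = 0")
  case True
  then show ?thesis by (auto simp: half_tan_def[abs_def] intro!: derivative_eq_intros)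
next
  case False
  have "\<bar>t * norm w / 2\<bar> < pi / 2" using assms by (simp add: abs_mult)
  then have "0 < cos (t * norm w / 2)" by (intro cos_gt_zero_pi) linarith+
  then have c: "cos (t * norm w / 2) \<noteq> 0" by simp
  have "((\<lambda>t. t * norm w / 2) has_real_derivative norm w / 2) (at t)"
    by (auto intro!: derivative_eq_intros)
  from DERIV_cdivide[OF DERIV_chain2[OF DERIV_tan[OF c] this], of "norm w"]
  have "(half_tan w has_real_derivative inverse ((cos (t * norm w / 2))\<^sup>2) * (norm w / 2) / norm w) (at t)"
    using False by (simp add: half_tan_def[abs_def])
  moreover have "inverse ((cos (t * norm w / 2))\<^sup>2) * (norm w / 2) / norm w = (1 + (norm w)\<^sup>2 * (half_tan w t)\<^sup>2) / 2"
    using False tan_sec[OF c] by (simp add: half_tan_def power_divide power_inverse)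
  ultimately show ?thesis by (rule DERIV_cong)
qed

text \<open>Rodrigues' composition law: multiply quaternions of scalar part 1 and rescale the
  product to scalar part 1 again. The excluded case is a product that is a half turn.\<close>

lemma cay_mult:
  assumes "x \<bullet> y \<noteq> 1"
  shows "cay x ** cay y = cay ((x + y + cross3 x y) /\<^sub>R (1 - x \<bullet> y))"
proof -
  define V where "V = x + y + cross3 x y"
  define c where "c = 1 - x \<bullet> y"
  have c: "c \<noteq> 0" using assms by (simp add: c_def)
  have n: "c\<^sup>2 + V \<bullet> V = (1 + x \<bullet> x) * (1 + y \<bullet> y)"
    using quat_norm_mult[of 1 1 x y] by (simp add: V_def c_def add.commute[of x y])
  have p: "0 < 1 + x \<bullet> x" "0 < 1 + y \<bullet> y" by (simp_all add: add_pos_nonneg)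
  have e: "1 + (V /\<^sub>R c) \<bullet> (V /\<^sub>R c) = (1 + x \<bullet> x) * (1 + y \<bullet> y) / c\<^sup>2"
    using c unfolding n[symmetric] by (simp add: field_simps power2_eq_square)
  have "cay x ** cay y = (1 / ((1 + x \<bullet> x) * (1 + y \<bullet> y))) *\<^sub>R quat_mat c V"
    by (simp add: cay_def scaleR_mult_mat quat_mat_mult V_def c_def add.commute[of y x])
  also have "quat_mat c V = c\<^sup>2 *\<^sub>R quat_mat 1 (V /\<^sub>R c)"
    using quat_mat_scale[of c 1 "V /\<^sub>R c"] c by simp
  also have "(1 / ((1 + x \<bullet> x) * (1 + y \<bullet> y))) *\<^sub>R (c\<^sup>2 *\<^sub>R quat_mat 1 (V /\<^sub>R c)) = cay (V /\<^sub>R c)"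
    unfolding cay_def e by simp
  finally show ?thesis by (simp only: V_def c_def)
qed

text \<open>Direction and parametrisation of the straight line traced, in Rodrigues coordinates,
  by the geodesic issuing from \<open>cay z\<close> with velocity \<open>w\<close>.\<close>
definition line_dir :: "real^3 \<Rightarrow> real^3 \<Rightarrow> real^3" where
  "line_dir z w = w + cross3 z w + (z \<bullet> w) *\<^sub>R z"

definition line_par :: "real^3 \<Rightarrow> real^3 \<Rightarrow> real \<Rightarrow> real" where
  "line_par z w t = half_tan w t / (1 - half_tan w t * (z \<bullet> w))"

text \<open>After subtracting \<open>z\<close>, the composition law leaves a scalar function of
  \<open>t\<close> times a vector free of \<open>t\<close>: the geodesic is a straight line.\<close>

lemma cay_mult_rot:
  assumes t: "\<bar>t\<bar> * norm w < pi" and nz: "half_tan w t * (z \<bullet> w) \<noteq> 1"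
  shows "cay z ** rot (t *\<^sub>R w) = cay (z + line_par z w t *\<^sub>R line_dir z w)"
proof -
  define \<tau> \<kappa> where "\<tau> = half_tan w t" and "\<kappa> = z \<bullet> w"
  have nz': "1 - \<tau> * \<kappa> \<noteq> 0" using nz by (simp add: \<tau>_def \<kappa>_def)
  have "(z + \<tau> *\<^sub>R w + cross3 z (\<tau> *\<^sub>R w)) /\<^sub>R (1 - \<tau> * \<kappa>) = z + (\<tau> / (1 - \<tau> * \<kappa>)) *\<^sub>R (w + cross3 z w + \<kappa> *\<^sub>R z)"
  proof -
    have "(1 - \<tau> * \<kappa>) *\<^sub>R (z + (\<tau> / (1 - \<tau> * \<kappa>)) *\<^sub>R (w + cross3 z w + \<kappa> *\<^sub>R z))
        = (1 - \<tau> * \<kappa>) *\<^sub>R z + \<tau> *\<^sub>R (w + cross3 z w + \<kappa> *\<^sub>R z)"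
      using nz' by (simp add: scaleR_add_right)
    also have "\<dots> = z + \<tau> *\<^sub>R w + cross3 z (\<tau> *\<^sub>R w)"
      by (simp add: scaleR_add_right scaleR_diff_left cross_mult_right)
    finally have "z + \<tau> *\<^sub>R w + cross3 z (\<tau> *\<^sub>R w) = (1 - \<tau> * \<kappa>) *\<^sub>R (z + (\<tau> / (1 - \<tau> * \<kappa>)) *\<^sub>R (w + cross3 z w + \<kappa> *\<^sub>R z))" ..
    then show ?thesis using nz' by simp
  qed
  then show ?thesis
    using cay_mult[of z "\<tau> *\<^sub>R w"] nz unfolding rot_eq_cay[OF t] line_par_def line_dir_def
    by (simp add: \<tau>_def \<kappa>_def)
qed

lemma jet2_line_par: "jet2 (line_par z w) (1/2) ((z \<bullet> w) / 2) 0"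
proof -
  define \<tau> \<kappa> where "\<tau> = half_tan w" and "\<kappa> = z \<bullet> w"
  \<comment> \<open>The quotient rule gives \<tau>' / (1 - \<tau> \<kappa>)^2, with \<tau>' replaced
    by the right side of the Riccati equation.\<close>
  define d where "d t = (1 + (norm w)\<^sup>2 * (\<tau> t)\<^sup>2) / (2 * (1 - \<tau> t * \<kappa>)\<^sup>2)" for t
  have \<tau>0: "\<tau> 0 = 0" by (simp add: \<tau>_def half_tan_def)
  have D: "(\<tau> has_real_derivative (1 + (norm w)\<^sup>2 * (\<tau> t)\<^sup>2) / 2) (at t)" if "\<bar>t\<bar> * norm w < pi" for t
    unfolding \<tau>_def by (rule DERIV_half_tan[OF that])
  have "isCont \<tau> 0" using D[of 0] by (intro DERIV_isCont) auto
  have o1: "\<forall>\<^sub>F t in nhds (0::real). \<bar>t\<bar> * norm w < pi"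
    using eventually_nhds_in_open[of "{t::real. \<bar>t\<bar> * norm w < pi}" 0]
    by (simp add: open_Collect_less continuous_intros)
  have "((\<lambda>t. \<tau> t * \<kappa>) \<longlongrightarrow> \<tau> 0 * \<kappa>) (nhds 0)"
    using \<open>isCont \<tau> 0\<close> by (intro tendsto_intros) (simp add: isCont_def tendsto_at_iff_tendsto_nhds)
  then have o2: "\<forall>\<^sub>F t in nhds 0. \<tau> t * \<kappa> < 1" by (rule order_tendstoD) (simp add: \<tau>0)
  show ?thesis
  proof (rule jet2I[where x' = d])
    show "\<forall>\<^sub>F t in nhds 0. (line_par z w has_vector_derivative d t) (at t)"
      using o1 o2
    proof eventually_elim
      case (elim t)
      then have nz: "1 - \<tau> t * \<kappa> \<noteq> 0" by simp
      have "((\<lambda>t. \<tau> t / (1 - \<tau> t * \<kappa>)) has_real_derivative d t) (at t)"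
      proof -
        define N where "N = (1 + (norm w)\<^sup>2 * (\<tau> t)\<^sup>2) / 2"
        have D': "((\<lambda>t. 1 - \<tau> t * \<kappa>) has_real_derivative - (N * \<kappa>)) (at t)"
          using DERIV_diff[OF DERIV_const DERIV_cmult_right[OF D[OF elim(1)]]] by (simp add: N_def)
        have "(\<tau> has_real_derivative N) (at t)" unfolding N_def by (rule D[OF elim(1)])
        note q = DERIV_divide[OF this D' nz]
        have "N * (1 - \<tau> t * \<kappa>) - \<tau> t * - (N * \<kappa>) = N" by (simp add: algebra_simps)
        moreover have "d t = N / ((1 - \<tau> t * \<kappa>) * (1 - \<tau> t * \<kappa>))"
          by (simp add: d_def N_def power2_eq_square)
        ultimately show ?thesis using q by (simp only:)
      qed
      then show ?case
        by (simp add: line_par_def[abs_def] \<tau>_def \<kappa>_def has_real_derivative_iff_has_vector_derivative)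
    qed
    show "d 0 = 1/2" by (simp add: d_def \<tau>0)
    have "(d has_real_derivative (z \<bullet> w) / 2) (at 0)"
      unfolding d_def
      by (rule derivative_eq_intros D refl | simp add: \<tau>0 \<kappa>_def power2_eq_square)+
    then show "(d has_vector_derivative (z \<bullet> w) / 2) (at 0)"
      by (simp add: has_real_derivative_iff_has_vector_derivative)
  qed
qed

text \<open>First and second derivatives at \<open>t = 0\<close> of the line, of its squared norm, and of its image
  under \<^const>\<open>cay_log\<close>.\<close>
definition line1 :: "real^3 \<Rightarrow> real^3 \<Rightarrow> real^3" where
  "line1 z w = (1/2) *\<^sub>R line_dir z w"

definition line2 :: "real^3 \<Rightarrow> real^3 \<Rightarrow> real^3" where
  "line2 z w = ((z \<bullet> w) / 2) *\<^sub>R line_dir z w"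

definition sqn1 :: "real^3 \<Rightarrow> real^3 \<Rightarrow> real" where
  "sqn1 z w = line1 z w \<bullet> z + z \<bullet> line1 z w"

definition sqn2 :: "real^3 \<Rightarrow> real^3 \<Rightarrow> real" where
  "sqn2 z w = line2 z w \<bullet> z + 2 *\<^sub>R (line1 z w \<bullet> line1 z w) + z \<bullet> line2 z w"

definition log1 :: "real^3 \<Rightarrow> real^3 \<Rightarrow> real^3" where
  "log1 z w = (2 * (sqn1 z w *\<^sub>R atn 1 (z \<bullet> z))) *\<^sub>R z + (2 * atn 0 (z \<bullet> z)) *\<^sub>R line1 z w"

definition log2 :: "real^3 \<Rightarrow> real^3 \<Rightarrow> real^3" where
  "log2 z w = (2 * (sqn2 z w *\<^sub>R atn 1 (z \<bullet> z) + (sqn1 z w * sqn1 z w) *\<^sub>R atn 2 (z \<bullet> z))) *\<^sub>R z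
     + 2 *\<^sub>R ((2 * (sqn1 z w *\<^sub>R atn 1 (z \<bullet> z))) *\<^sub>R line1 z w) + (2 * atn 0 (z \<bullet> z)) *\<^sub>R line2 z w"

lemma line_par_0: "line_par z w 0 = 0"
  by (simp add: line_par_def half_tan_def)

lemma jet2_line: "jet2 (\<lambda>t. z + line_par z w t *\<^sub>R line_dir z w) (line1 z w) (line2 z w) 0"
  using jet2_add[OF jet2_const[of z] jet2_linear[OF bounded_linear_scaleR_left jet2_line_par]]
  by (simp add: line1_def line2_def)

lemma jet2_cay_log_line:
  assumes "norm z < 1"
  shows "jet2 (\<lambda>t. cay_log (z + line_par z w t *\<^sub>R line_dir z w)) (log1 z w) (log2 z w) 0"
proof -
  let ?z = "\<lambda>t. z + line_par z w t *\<^sub>R line_dir z w"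
  have z: "jet2 ?z (line1 z w) (line2 z w) 0" by (rule jet2_line)
  have s: "\<bar>z \<bullet> z\<bar> < 1"
    using assms by (simp add: power2_norm_eq_inner[symmetric] abs_square_less_1)
  have n: "jet2 (\<lambda>t. ?z t \<bullet> ?z t) (sqn1 z w) (sqn2 z w) 0"
    using bounded_bilinear.jet2[OF bounded_bilinear_inner z z]
    by (simp add: line_par_0 sqn1_def sqn2_def)
  have "jet2 (\<lambda>t. atn 0 (?z t \<bullet> ?z t)) (sqn1 z w *\<^sub>R atn 1 (z \<bullet> z))
     (sqn2 z w *\<^sub>R atn 1 (z \<bullet> z) + (sqn1 z w * sqn1 z w) *\<^sub>R atn 2 (z \<bullet> z)) 0"
    by (rule jet2_compose_real[OF _ n]) (simp only: line_par_0 scaleR_zero_left add_0_right jet2_atn[OF s])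
  from jet2_linear[OF bounded_linear_mult_right[of 2] this]
  have "jet2 (\<lambda>t. 2 * atn 0 (?z t \<bullet> ?z t)) (2 * (sqn1 z w *\<^sub>R atn 1 (z \<bullet> z)))
     (2 * (sqn2 z w *\<^sub>R atn 1 (z \<bullet> z) + (sqn1 z w * sqn1 z w) *\<^sub>R atn 2 (z \<bullet> z))) 0" .
  from bounded_bilinear.jet2[OF bounded_bilinear_scaleR this z]
  show ?thesis by (simp only: cay_log_def log1_def log2_def line_par_0 scaleR_zero_left add_0_right)
qed

text \<open>The homogeneity of degree one here and in \<open>log1\<close>, and two in
  \<open>log2\<close>, later extends positivity from the unit sphere to all horizontal
  vectors.\<close>

lemma line_dir_scaleR: "line_dir z (c *\<^sub>R w) = c *\<^sub>R line_dir z w"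
  by (simp add: line_dir_def cross_mult_right scaleR_add_right)

lemma log1_scaleR: "log1 z (c *\<^sub>R w) = c *\<^sub>R log1 z w"
  by (simp add: log1_def sqn1_def line1_def line_dir_scaleR algebra_simps)

lemma log2_scaleR: "log2 z (c *\<^sub>R w) = (c * c) *\<^sub>R log2 z w"
  by (simp add: log2_def sqn1_def sqn2_def line1_def line2_def line_dir_scaleR algebra_simps)

lemma continuous_on_atn_inner:
  fixes f :: "'b::topological_space \<Rightarrow> real^3"
  assumes "continuous_on X f" "\<And>x. x \<in> X \<Longrightarrow> norm (f x) < 1"
  shows "continuous_on X (\<lambda>x. atn m (f x \<bullet> f x))"
proof (rule continuous_on_compose2[OF continuous_on_atn])
  have "f x \<bullet> f x < 1" if "x \<in> X" for x
    using assms(2)[OF that] by (simp add: power2_norm_eq_inner[symmetric] abs_square_less_1)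
  moreover have "- 1 < f x \<bullet> f x" for x
    using inner_ge_zero[of "f x"] by linarith
  ultimately show "(\<lambda>x. f x \<bullet> f x) ` X \<subseteq> {-1<..<1}" by auto
qed (intro continuous_intros assms)

lemma continuous_on_log_jet:
  fixes f g :: "'b::t2_space \<Rightarrow> real^3"
  assumes "continuous_on X f" "continuous_on X g" "\<And>x. x \<in> X \<Longrightarrow> norm (f x) < 1"
  shows "continuous_on X (\<lambda>x. cay_log (f x))"
    and "continuous_on X (\<lambda>x. log1 (f x) (g x))" and "continuous_on X (\<lambda>x. log2 (f x) (g x))"
proof -
  note a = continuous_on_atn_inner[OF assms(1,3)]
  have d: "continuous_on X (\<lambda>x. line_dir (f x) (g x))"
    unfolding line_dir_def by (intro continuous_intros continuous_on_cross assms)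
  show "continuous_on X (\<lambda>x. cay_log (f x))"
    unfolding cay_log_def by (intro continuous_intros a assms)
  show "continuous_on X (\<lambda>x. log1 (f x) (g x))"
    unfolding log1_def sqn1_def line1_def by (intro continuous_intros a d assms)
  show "continuous_on X (\<lambda>x. log2 (f x) (g x))"
    unfolding log2_def sqn1_def sqn2_def line1_def line2_def by (intro continuous_intros a d assms) auto
qed

lemma eventually_cay_mult_rot:
  assumes z: "norm z < 1"
  shows "\<forall>\<^sub>F t in nhds 0. cay z ** rot (t *\<^sub>R w) = rot (cay_log (z + line_par z w t *\<^sub>R line_dir z w))"
proof -
  have o1: "\<forall>\<^sub>F t in nhds (0::real). \<bar>t\<bar> * norm w < pi"
    using eventually_nhds_in_open[of "{t::real. \<bar>t\<bar> * norm w < pi}" 0]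
    by (simp add: open_Collect_less continuous_intros)
  have "isCont (half_tan w) 0" using DERIV_half_tan[of 0 w] by (intro DERIV_isCont) auto
  then have "((\<lambda>t. half_tan w t * (z \<bullet> w)) \<longlongrightarrow> half_tan w 0 * (z \<bullet> w)) (nhds 0)"
    by (intro tendsto_intros) (simp add: isCont_def tendsto_at_iff_tendsto_nhds)
  then have o2: "\<forall>\<^sub>F t in nhds 0. half_tan w t * (z \<bullet> w) < 1"
    by (rule order_tendstoD) (simp add: half_tan_def)
  define Y where "Y t = z + line_par z w t *\<^sub>R line_dir z w" for t
  have "isCont Y 0" unfolding Y_def using jet2E[OF jet2_line[of z w]] by blast
  then have "((\<lambda>t. norm (Y t)) \<longlongrightarrow> norm (Y 0)) (nhds 0)"
    by (intro tendsto_norm) (simp add: isCont_def tendsto_at_iff_tendsto_nhds)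
  then have "\<forall>\<^sub>F t in nhds 0. norm (Y t) < 1"
    by (rule order_tendstoD) (simp add: Y_def line_par_0 z)
  then have o3: "\<forall>\<^sub>F t in nhds 0. norm (z + line_par z w t *\<^sub>R line_dir z w) < 1"
    by (simp only: Y_def)
  show ?thesis
    using o1 o2 o3 by eventually_elim (simp add: cay_mult_rot rot_cay_log)
qed

section \<open>Positivity of the second derivative near the given configuration\<close>

definition cay_config :: "('n::finite) config \<Rightarrow> 'n tangent \<Rightarrow> 'n config" where
  "cay_config R Z = (\<chi> i. R $ i ** cay (Z $ i))"

lemma positive_second_derivative_near:
  fixes f :: "('n::finite) config \<Rightarrow> real" and R :: "'n config" and H :: "real ^ ('n \<times> 3) ^ ('n \<times> 3)"
  assumes C2: "C2_near f R" and H: "is_riemannian_hessian f R H"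
    and pos: "(INF x\<in>{x \<in> orthogonal_comp vertical_space. norm x = 1}. quad_form H x) > 0"
  obtains \<delta> where "\<delta> > 0" "\<And>Z w. norm Z < \<delta> \<Longrightarrow> w \<in> orthogonal_comp vertical_space \<Longrightarrow>
      \<exists>q\<ge>0. \<exists>g. jet2 (\<lambda>t. f (config_exp (cay_config R Z) (t *\<^sub>R w))) g q 0"
proof -
  define g where "g x = f (config_exp R x)" for x
  obtain r f' f'' where r: "0 < r"
    and f': "\<And>x. x \<in> ball 0 r \<Longrightarrow> (g has_derivative blinfun_apply (f' x)) (at x)"
    and f'': "\<And>x. x \<in> ball 0 r \<Longrightarrow> (f' has_derivative blinfun_apply (f'' x)) (at x)"
    and cont'': "continuous_on (ball 0 r) f''"
    using C2 unfolding C2_near_def C2_on_def g_def[symmetric] by metis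
  have cont': "continuous_on (ball 0 r) f'"
    by (intro continuous_at_imp_continuous_on ballI has_derivative_continuous[OF f''])
  define L :: "'n tangent \<Rightarrow> 'n tangent" where "L Z = (\<chi> i. cay_log (Z $ i))" for Z
  define L1 L2 :: "'n tangent \<Rightarrow> 'n tangent \<Rightarrow> 'n tangent" 
    where "L1 Z w = (\<chi> i. log1 (Z $ i) (w $ i))" and "L2 Z w = (\<chi> i. log2 (Z $ i) (w $ i))" for Z w
  \<comment> \<open>The second derivative along the geodesic from \<open>cay_config R Z\<close> with
    velocity \<open>w\<close>, as an explicit expression whose continuity in both arguments can be
    checked.\<close>
  define Q where "Q Z w = f'' (L Z) (L1 Z w) (L1 Z w) + f' (L Z) (L2 Z w)" for Z w
  have comp_less: "norm (Z $ i) < 1" if "norm Z < 1" for Z :: "'n tangent" and i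
    using Finite_Cartesian_Product.norm_nth_le[of Z i] that by linarith
  have "continuous_on (ball 0 1) L"
    unfolding L_def by (intro continuous_on_vec_lambda continuous_on_log_jet(1)[where g = "\<lambda>x. 0"] continuous_intros)
      (simp add: comp_less)
  then have "open (ball 0 1 \<inter> L -` ball 0 r)"
    by (intro continuous_open_preimage) auto
  moreover have "L 0 = 0" by (simp add: L_def cay_log_def vec_eq_iff)
  then have "0 \<in> ball 0 1 \<inter> L -` ball 0 r" using r by simp
  ultimately obtain \<rho> where \<rho>: "0 < \<rho>" "cball 0 \<rho> \<subseteq> ball 0 1 \<inter> L -` ball 0 r"
    by (meson open_contains_cball)
  then have LZ: "norm Z < 1" "L Z \<in> ball 0 r" if "norm Z \<le> \<rho>" for Z
    using that by auto

  have jet: "jet2 (\<lambda>t. f (config_exp (cay_config R Z) (t *\<^sub>R w))) (f' (L Z) (L1 Z w)) (Q Z w) 0"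
    if Z: "norm Z \<le> \<rho>" for Z w
  proof -
    \<comment> \<open>The geodesic in the exponential chart at \<open>R\<close>, valid for small
      \<open>t\<close>.\<close>
    define x :: "real \<Rightarrow> 'n tangent"
      where "x t = (\<chi> i. cay_log (Z $ i + line_par (Z $ i) (w $ i) t *\<^sub>R line_dir (Z $ i) (w $ i)))" for t
    have x0: "x 0 = L Z" by (simp add: x_def L_def line_par_0)
    have "jet2 x (L1 Z w) (L2 Z w) 0"
      by (rule jet2_vec) (simp add: x_def L1_def L2_def jet2_cay_log_line comp_less LZ(1)[OF Z])
    then have J: "jet2 (\<lambda>t. g (x t)) (f' (x 0) (L1 Z w)) (f'' (x 0) (L1 Z w) (L1 Z w) + f' (x 0) (L2 Z w)) 0"
      by (intro jet2_C2[where U = "ball 0 r"] f' f'') (simp_all only: open_ball x0 LZ(2)[OF Z])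
    have "\<forall>\<^sub>F t in nhds 0. \<forall>i. cay (Z $ i) ** rot (t *\<^sub>R w $ i) = rot (x t $ i)"
      unfolding x_def vec_lambda_beta
      by (intro eventually_all_finite eventually_cay_mult_rot comp_less LZ(1)[OF Z])
    then have "\<forall>\<^sub>F t in nhds 0. f (config_exp (cay_config R Z) (t *\<^sub>R w)) = g (x t)"
    proof eventually_elim
      case (elim t)
      then have "config_exp (cay_config R Z) (t *\<^sub>R w) = config_exp R (x t)"
        by (simp add: config_exp_def cay_config_def flip: matrix_mul_assoc)
      then show ?case by (simp add: g_def)
    qed
    from jet2_cong[OF this J] show ?thesis by (simp add: Q_def x0)
  qed

  have Q0: "Q 0 w = quad_form H w" for w
  proof -
    have "cay_config R 0 = R" by (simp add: cay_config_def cay_def quat_mat_one vec_eq_iff)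
    then have "has_second_derivative (\<lambda>t. f (config_exp R (t *\<^sub>R w))) (Q 0 w) 0"
      using jet2_imp_has_second_derivative[OF jet[of 0 w]] \<rho>(1) by simp
    then show ?thesis
      using H unfolding is_riemannian_hessian_def by (metis has_second_derivative_unique)
  qed

  have Q_scale: "Q Z (c *\<^sub>R w) = (c * c) * Q Z w" for Z c w
  proof -
    have "L1 Z (c *\<^sub>R w) = c *\<^sub>R L1 Z w" "L2 Z (c *\<^sub>R w) = (c * c) *\<^sub>R L2 Z w"
      by (simp_all add: L1_def L2_def log1_scaleR log2_scaleR vec_eq_iff)
    then show ?thesis
      by (simp add: Q_def blinfun.scaleR_right blinfun.scaleR_left algebra_simps)
  qed

  define K :: "'n tangent set" where "K = {x \<in> orthogonal_comp vertical_space. norm x = 1}"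
  have "K = orthogonal_comp vertical_space \<inter> sphere 0 1" by (auto simp: K_def)
  then have K: "compact K"
    by (metis closed_Int_compact closed_subspace compact_sphere subspace_orthogonal_comp)
  have Qcont: "continuous_on (cball 0 \<rho> \<times> K) (\<lambda>x. Q (fst x) (snd x))"
  proof -
    have nz: "norm (fst x $ i) < 1" if "x \<in> cball 0 \<rho> \<times> K" for x :: "'n tangent \<times> 'n tangent" and i
      using that by (intro comp_less LZ(1)) auto
    have c: "continuous_on (cball (0 :: 'n tangent) \<rho> \<times> K) (\<lambda>x. fst x $ i)" "continuous_on (cball (0 :: 'n tangent) \<rho> \<times> K) (\<lambda>x. snd x $ i)" for i
      by (intro continuous_intros)+
    note cl = continuous_on_log_jet[OF c nz]
    have cL: "continuous_on (cball 0 \<rho> \<times> K) (\<lambda>x. L (fst x))"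
      unfolding L_def by (intro continuous_on_vec_lambda cl)
    have c1: "continuous_on (cball 0 \<rho> \<times> K) (\<lambda>x. L1 (fst x) (snd x))"
      unfolding L1_def by (intro continuous_on_vec_lambda cl)
    have c2: "continuous_on (cball 0 \<rho> \<times> K) (\<lambda>x. L2 (fst x) (snd x))"
      unfolding L2_def by (intro continuous_on_vec_lambda cl)
    have im: "(\<lambda>x. L (fst x)) ` (cball 0 \<rho> \<times> K) \<subseteq> ball 0 r"
      using LZ(2) by auto
    show ?thesis
      unfolding Q_def
      by (intro continuous_on_add bounded_bilinear.continuous_on[OF bounded_bilinear_blinfun_apply]
          continuous_on_compose2[OF cont' cL im] continuous_on_compose2[OF cont'' cL im] c1 c2)
  qed

  define \<kappa> where "\<kappa> = (INF x\<in>K. quad_form H x)"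
  have \<kappa>: "\<kappa> > 0" using pos by (simp add: \<kappa>_def K_def)
  have lower: "\<kappa> \<le> Q 0 w" if "w \<in> K" for w
  proof -
    have "continuous_on K (\<lambda>w. Q (fst (0, w)) (snd (0 :: 'n tangent, w)))"
    proof (rule continuous_on_compose2[OF Qcont])
      show "continuous_on K (\<lambda>w. (0 :: 'n tangent, w))" by (intro continuous_intros)
      show "(\<lambda>w. (0, w)) ` K \<subseteq> cball 0 \<rho> \<times> K" using \<rho>(1) by auto
    qed
    then have "continuous_on K (\<lambda>w. Q 0 w)" by simp
    then have "bdd_below ((\<lambda>w. Q 0 w) ` K)"
      using K by (intro bounded_imp_bdd_below compact_imp_bounded compact_continuous_image)
    then show ?thesis unfolding \<kappa>_def Q0 using that by (intro cINF_lower)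
  qed
  \<comment> \<open>Uniformity over the compact product yields one radius \<open>d\<close> for all
    unit directions; the tolerance \<kappa> is the lower bound at \<open>Z = 0\<close>, so
    positivity survives.\<close>
  have "uniformly_continuous_on (cball 0 \<rho> \<times> K) (\<lambda>x. Q (fst x) (snd x))"
    by (intro compact_uniformly_continuous Qcont compact_Times compact_cball K)
  then obtain d where d: "0 < d"
    and Qd: "\<And>x y. x \<in> cball 0 \<rho> \<times> K \<Longrightarrow> y \<in> cball 0 \<rho> \<times> K \<Longrightarrow> dist y x < d \<Longrightarrow>
       dist (Q (fst y) (snd y)) (Q (fst x) (snd x)) < \<kappa>"
    using \<kappa> unfolding uniformly_continuous_on_def by metis
  have Qpos: "Q Z w > 0" if "norm Z < d" "norm Z \<le> \<rho>" "w \<in> K" for Z w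
  proof -
    have "dist (Q Z w) (Q 0 w) < \<kappa>"
      using Qd[of "(0, w)" "(Z, w)"] that \<rho>(1) by (simp add: dist_Pair_Pair)
    with lower[OF that(3)] show ?thesis by (simp add: dist_real_def)
  qed
  show ?thesis
  proof (rule that[of "min \<rho> d"])
    show "0 < min \<rho> d" using \<rho>(1) d by simp
    fix Z w :: "'n tangent"
    assume Z: "norm Z < min \<rho> d" and w: "w \<in> orthogonal_comp vertical_space"
    have "0 \<le> Q Z w"
    \<comment> \<open>The zero vector cannot be normalised. With a single vertex it is the only
      horizontal vector and \<open>K\<close> is empty.\<close>
    proof (cases "w = 0")
      case True
      then show ?thesis using Q_scale[of Z 0 0] by simp
    next
      case False
      have "w /\<^sub>R norm w \<in> K"
        using w False unfolding K_def by (simp add: subspace_scale subspace_orthogonal_comp)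
      then have "0 < Q Z (w /\<^sub>R norm w)" using Z by (intro Qpos) auto
      moreover have "Q Z w = (norm w * norm w) * Q Z (w /\<^sub>R norm w)"
        using Q_scale[of Z "norm w" "w /\<^sub>R norm w"] False by simp
      ultimately show ?thesis by simp
    qed
    moreover have "jet2 (\<lambda>t. f (config_exp (cay_config R Z) (t *\<^sub>R w))) (f' (L Z) (L1 Z w)) (Q Z w) 0"
      using Z by (intro jet) simp
    ultimately show "\<exists>q\<ge>0. \<exists>g. jet2 (\<lambda>t. f (config_exp (cay_config R Z) (t *\<^sub>R w))) g q 0"
      by blast
  qed
qed

text \<open>Every component of \<open>Z\<close> is shorter than \<open>d\<close>; bounding the
  Euclidean norm by the sum of the component norms produces the factor
  \<open>CARD('n)\<close>.\<close>

lemma config_exp_eq_cay_config: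
  fixes y :: "('n::finite) tangent"
  assumes "norm y < 2 * arctan d"
  obtains Z where "norm Z < real CARD('n) * d" "config_exp R y = cay_config R Z"
proof -
  define Z :: "'n tangent" where "Z = (\<chi> i. half_tan (y $ i) 1 *\<^sub>R y $ i)"
  have y: "norm (y $ i) < 2 * arctan d" for i
    using Finite_Cartesian_Product.norm_nth_le[of y i] assms by linarith
  have "norm Z \<le> (\<Sum>i\<in>UNIV. norm (Z $ i))"
    unfolding norm_vec_def[of Z] by (rule L2_set_le_sum) simp
  also have "\<dots> < of_nat (card (UNIV :: 'n set)) * d"
    by (rule sum_bounded_above_strict) (simp_all add: Z_def norm_half_tan_less[OF y] del: norm_scaleR)
  finally have n: "norm Z < real CARD('n) * d" .
  have "rot (y $ i) = cay (Z $ i)" for i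
  proof -
    have "norm (y $ i) < pi" using y[of i] arctan_ubound[of d] by linarith
    then show ?thesis using rot_eq_cay[of 1 "y $ i"] by (simp add: Z_def)
  qed
  then have "config_exp R y = cay_config R Z" by (simp add: config_exp_def cay_config_def)
  with n show ?thesis by (rule that)
qed

theorem theorem1:
  fixes p :: real
    and E :: "('n::finite \<times> 'n) set"
    and Rt :: "'n \<Rightarrow> 'n \<Rightarrow> real^3^3"
    and R :: "'n config"
    and H :: "real ^ ('n \<times> 3) ^ ('n \<times> 3)"
  assumes "p > 1"
    and "oriented_connected_graph E"
    and "\<And>i j. (i, j) \<in> E \<Longrightarrow> Rt i j \<in> SO3"
    and "R \<in> SO3n"
    and "C2_near (averaging_cost p E Rt) R"
    and "is_riemannian_hessian (averaging_cost p E Rt) R H"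
    and "(INF x\<in>{x \<in> orthogonal_comp vertical_space. norm x = 1}. quad_form H x) > 0"
  shows "quot_locally_convex_at (quot_fun (averaging_cost p E Rt)) (gauge_class R)"
proof -
  let ?f = "averaging_cost p E Rt"
  obtain \<delta> where \<delta>: "\<delta> > 0" and near: "\<And>Z w. norm Z < \<delta> \<Longrightarrow> w \<in> orthogonal_comp vertical_space \<Longrightarrow>
      \<exists>q\<ge>0. \<exists>g. jet2 (\<lambda>t. ?f (config_exp (cay_config R Z) (t *\<^sub>R w))) g q 0"
    using positive_second_derivative_near[OF assms(5-7)] by blast
  \<comment> \<open>Chosen to cancel the factor \<open>CARD('n)\<close>, so that the ball of radius
    2 arctan d lies where \<open>near\<close> applies.\<close>
  define d where "d = \<delta> / real CARD('n)"
  have d: "0 < d" "real CARD('n) * d = \<delta>" using \<delta> by (simp_all add: d_def)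
  have "convex_on {a..b} (\<lambda>t. quot_fun ?f (\<gamma> t))"
    if geo: "quot_geodesic \<gamma> a b" and ball: "\<gamma> ` {a..b} \<subseteq> quot_ball (gauge_class R) (2 * arctan d)"
    for \<gamma> :: "real \<Rightarrow> 'n config set" and a b
  proof (rule convex_on_Icc_second_derivative)
    show "continuous_on {a..b} (\<lambda>t. quot_fun ?f (\<gamma> t))"
      by (rule continuous_on_cost_geodesic[OF geo assms(1,3)])
    fix t assume t: "a < t" "t < b"
    obtain M w where M: "M \<in> SO3n" and w: "w \<in> orthogonal_comp vertical_space"
      and lift: "\<forall>\<^sub>F s in nhds t. \<gamma> s = gauge_class (config_exp M ((s - t) *\<^sub>R w))"
      using quot_geodesic_lift[OF geo t] by blast
    have "\<gamma> t = gauge_class M"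
      using eventually_nhds_x_imp_x[OF lift] by (simp add: config_exp_zero)
    moreover have "\<gamma> t \<in> quot_ball (gauge_class R) (2 * arctan d)" using ball t by auto
    ultimately have "gauge_dist R M < 2 * arctan d"
      by (simp add: quot_ball_def quot_dist_class M assms(4))
    \<comment> \<open>Closeness of classes concerns only suitable representatives: \<open>S\<close>
      moves the lift itself close to \<open>R\<close>.\<close>
    then obtain S where S: "S \<in> SO3" "config_dist R (gauge_act M S) < 2 * arctan d"
      using gauge_dist_attained[OF assms(4) M] by metis
    obtain y where y: "gauge_act M S = config_exp R y" "norm y < 2 * arctan d"
      using config_eq_exp[OF assms(4) gauge_act_SO3n[OF M S(1)]] S(2) by metis
    obtain Z where Z: "norm Z < \<delta>" "gauge_act M S = cay_config R Z"
      using config_exp_eq_cay_config[OF y(2), of R] y(1) d(2) by metis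
    define w' :: "'n tangent" where "w' = (\<chi> i. transpose S *v w $ i)"
    \<comment> \<open>A common rotation of all components maps the vertical space onto itself, hence
      preserves its orthogonal complement.\<close>
    have w': "w' \<in> orthogonal_comp vertical_space"
      using w unfolding orthogonal_comp_vertical_iff by (simp add: w'_def dot_lmul_matrix)
    obtain q g where q: "0 \<le> q" and jet: "jet2 (\<lambda>t. ?f (config_exp (cay_config R Z) (t *\<^sub>R w'))) g q 0"
      using near[OF Z(1) w'] by blast
    have shift: "jet2 (\<lambda>s. s - t) 1 0 t"
      by (rule jet2I[where x' = "\<lambda>_. 1"]) (auto intro!: always_eventually derivative_eq_intros)
    have J: "jet2 (\<lambda>s. ?f (config_exp (cay_config R Z) ((s - t) *\<^sub>R w'))) g q t"
      using jet2_compose_real[OF _ shift, of "\<lambda>t. ?f (config_exp (cay_config R Z) (t *\<^sub>R w'))" g q] jet by simp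
    have ev: "\<forall>\<^sub>F s in nhds t. quot_fun ?f (\<gamma> s) = ?f (config_exp (cay_config R Z) ((s - t) *\<^sub>R w'))"
      using lift
    proof eventually_elim
      case (elim s)
      have "quot_fun ?f (\<gamma> s) = ?f (config_exp M ((s - t) *\<^sub>R w))"
        unfolding elim by (intro quot_fun_averaging_cost config_exp_SO3n M)
      also have "\<dots> = ?f (gauge_act (config_exp M ((s - t) *\<^sub>R w)) S)"
        by (simp add: averaging_cost_gauge S)
      also have "gauge_act (config_exp M ((s - t) *\<^sub>R w)) S = config_exp (cay_config R Z) ((s - t) *\<^sub>R w')"
      proof -
        have "(\<chi> i. transpose S *v ((s - t) *\<^sub>R w) $ i) = (s - t) *\<^sub>R w'"
          by (simp add: w'_def vec_eq_iff matrix_vector_mult_scaleR del: transpose_matrix_vector)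
        then show ?thesis by (simp only: gauge_act_config_exp[OF S(1)] Z(2))
      qed
      finally show ?case .
    qed
    show "\<exists>q\<ge>0. has_second_derivative (\<lambda>t. quot_fun ?f (\<gamma> t)) q t"
      using jet2_imp_has_second_derivative[OF jet2_cong[OF ev J]] q by blast
  qed
  moreover have "0 < 2 * arctan d" using d by simp
  ultimately show ?thesis
    unfolding quot_locally_convex_at_def quot_convex_on_def by blast
qed

end
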